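(* Let $A$ be a finite abelian group with $|A|\ge 3$, let $f$ be an automorphism of $A$ of order $2$, let $y\in A$ satisfy $f(y)=y$, and let $G=\langle A, x \mid x^2=y,\ xax^{-1}=f(a)\ (a\in A)\rangle$. Let $B=\{f(a)a^{-1} : a\in A\}$. Let $S\subseteq G\setminus\{1\}$ and $T=\{s\in S : s^{-1}\notin S\}$. Write $S\setminus T=S_1\cup xS_2$ and $T=T_1\cup xT_2$ with $S_1,S_2,T_1,T_2\subseteq A$. Then the mixed Cayley graph $\mathrm{Cay}(G,S)$ is integral if and only if the following two conditions hold: (1) $\rho(S_1)+\rho(x)\rho(S_2)-2\,\mathrm{Im}(\rho(T_1))-2\,\mathrm{Im}(\rho(x)\rho(T_2))\in\mathbb{Z}$ for every one-dimensional representation $\rho:G\to\mathbb{C}^*$ of $G$; (2) for every one-dimensional representation $\pi:A\to\mathbb{C}^*$ of $A$ with $B\not\subseteq\ker(\pi)$, we have $\delta(\pi)\in\mathbb{Z}$ and there exists $\zeta\in\mathbb{Z}$ such that $\delta(\pi)^2-4\epsilon(\pi)=\zeta^2$, where $\alpha(\pi)=\pi(T_1)-\pi(T_1^{-1})$, $\beta(\pi)=\pi(yf(T_2))-\pi(T_2^{-1})$, $\gamma(\pi)=\pi(f(T_1))-\pi(f(T_1^{-1}))$, $\delta(\pi)=\pi(f(S_1))+\pi(S_1)+\mathbf{i}(\alpha(\pi)+\gamma(\pi))$, and $\epsilon(\pi)=\pi(S_1)\pi(f(S_1))-\pi(S_2)\pi(S_2^{-1})+\mathbf{i}\big(\pi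(S_1)\gamma(\pi)+\pi(f(S_1))\alpha(\pi)-\beta(\pi)\pi(S_2)+\overline{\beta(\pi)}\pi(S_2^{-1})\big)-\alpha(\pi)\gamma(\pi)-\beta(\pi)\overline{\beta(\pi)}$.
   Context: The presentation means $G$ is generated by $A$ and an element $x$ subject to the relations of $A$ together with $x^2=y$ and $xax^{-1}=f(a)$ for all $a\in A$; $A$ is a subgroup of index 2 of $G$ and $G$ is the disjoint union of $A$ and $xA$. $\mathbf{i}=\sqrt{-1}$ and $\mathrm{Im}$ denotes imaginary part. For a finite set $S$ and a function $h$ defined on $S$ (or on a set containing it), $h(S)=\sum_{s\in S}h(s)$; for a subset $S$ of a group and a nonzero integer $n$, $S^n=\{s^n: s\in S\}$, and $f(S)=\{f(s):s\in S\}$, $yf(S)=\{yf(s): s\in S\}$. For a finite group $G$ and $S\subseteq G\setminus\{1\}$, the mixed Cayley graph $\mathrm{Cay}(G,S)$ has vertex set $G$ and arc set $\{(g,h)\in G^2 : g^{-1}h\in S\}$. Its Hermitian adjacency matrix is the $G\times G$ matrix whose $(g,h)$-entry is $1$ if both $(g,h)$ and $(h,g)$ are arcs, $\mathbf{i}$ if $(g,h)$ is an arc and $(h,g)$ is not, $-\mathbf{i}$ if $(h,g)$ is an arc and $(g,h)$ is not, and $0$ otherwise. A mixed graph is integral if all eigenvalues of its Hermitian adjacency matrix are integers. *)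

theory Defs
  imports Complex_Main "HOL-Algebra.Algebra" "Graph_Theory.Pair_Digraph"
begin

text \<open>
  \<^term>\<open>G\<close> is the group \<open>\<langle>A, x | x\<^sup>2 = y, x a x\<^sup>-\<^sup>1 = f a (a \<in> A)\<rangle>\<close>, with \<^term>\<open>A\<close> realised as
  a subgroup of \<^term>\<open>G\<close>. That these conditions describe exactly the presented group is shown by the
  universal property \<open>index2_presentation_universal\<close> and by \<open>index2_presentation_exists\<close> below.
\<close>

definition index2_presentation ::
    "'a monoid \<Rightarrow> 'a monoid \<Rightarrow> ('a \<Rightarrow> 'a) \<Rightarrow> 'a \<Rightarrow> 'a \<Rightarrow> bool" where
  "index2_presentation G A f y x \<longleftrightarrow>
     group G \<and> subgroup (carrier A) G \<and> A = G\<lparr>carrier := carrier A\<rparr> \<and>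
     x \<in> carrier G \<and> generate G (carrier A \<union> {x}) = carrier G \<and>
     x \<otimes>\<^bsub>G\<^esub> x = y \<and> (\<forall>a\<in>carrier A. x \<otimes>\<^bsub>G\<^esub> a \<otimes>\<^bsub>G\<^esub> inv\<^bsub>G\<^esub> x = f a) \<and>
     card (rcosets\<^bsub>G\<^esub> (carrier A)) = 2 \<and>
     carrier G = carrier A \<union> (x <#\<^bsub>G\<^esub> carrier A) \<and>
     carrier A \<inter> (x <#\<^bsub>G\<^esub> carrier A) = {}"

definition complex_units :: "complex monoid" where
  "complex_units = \<lparr>carrier = UNIV - {0}, monoid.mult = (*), one = 1\<rparr>"

definition Cay :: "'a monoid \<Rightarrow> 'a set \<Rightarrow> 'a pair_pre_digraph" where
  "Cay G S = \<lparr>pverts = carrier G,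
              parcs = {(g, h) \<in> carrier G \<times> carrier G. inv\<^bsub>G\<^esub> g \<otimes>\<^bsub>G\<^esub> h \<in> S}\<rparr>"

text \<open>Square matrices indexed by a finite set \<open>V\<close> are functions of two arguments, of which only the
  values on \<open>V\<close> matter.\<close>

definition hermitian_adjacency :: "'v pair_pre_digraph \<Rightarrow> 'v \<Rightarrow> 'v \<Rightarrow> complex" where
  "hermitian_adjacency D g h =
     (if (g, h) \<in> parcs D \<and> (h, g) \<in> parcs D then 1
      else if (g, h) \<in> parcs D then \<i>
      else if (h, g) \<in> parcs D then - \<i>
      else 0)"

definition matrix_eigenvalue :: "'v set \<Rightarrow> ('v \<Rightarrow> 'v \<Rightarrow> complex) \<Rightarrow> complex \<Rightarrow> bool" where
  "matrix_eigenvalue V M k \<longleftrightarrow>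
     (\<exists>v. (\<exists>g\<in>V. v g \<noteq> 0) \<and> (\<forall>g\<in>V. (\<Sum>h\<in>V. M g h * v h) = k * v g))"

definition integral_mixed_graph :: "'v pair_pre_digraph \<Rightarrow> bool" where
  "integral_mixed_graph D \<longleftrightarrow>
     (\<forall>k. matrix_eigenvalue (pverts D) (hermitian_adjacency D) k \<longrightarrow> k \<in> \<int>)"

lemma index2_presentation_universal:
  fixes G A :: "'a monoid" and H :: "('b, 'c) monoid_scheme"
  assumes P: "index2_presentation G A f y x" and A: "comm_group A"
    and f: "f \<in> carrier A \<rightarrow> carrier A" and y: "y \<in> carrier A"
    and H: "group H" and \<phi>: "\<phi> \<in> hom A H" and h: "h \<in> carrier H"
    and hy: "h \<otimes>\<^bsub>H\<^esub> h = \<phi> y"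
    and hf: "\<And>a. a \<in> carrier A \<Longrightarrow> h \<otimes>\<^bsub>H\<^esub> \<phi> a \<otimes>\<^bsub>H\<^esub> inv\<^bsub>H\<^esub> h = \<phi> (f a)"
  shows "\<exists>\<psi>\<in>hom G H. (\<forall>a\<in>carrier A. \<psi> a = \<phi> a) \<and> \<psi> x = h"
proof -
  interpret G: group G using P by (simp add: index2_presentation_def)
  interpret H: group H by (rule H)
  interpret A: comm_group A by (rule A)
  have sub: "subgroup (carrier A) G" and AG: "A = G\<lparr>carrier := carrier A\<rparr>"
    and x: "x \<in> carrier G" and xx: "x \<otimes>\<^bsub>G\<^esub> x = y"
    and xf: "\<And>a. a \<in> carrier A \<Longrightarrow> x \<otimes>\<^bsub>G\<^esub> a \<otimes>\<^bsub>G\<^esub> inv\<^bsub>G\<^esub> x = f a"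
    and GA: "carrier G = carrier A \<union> (x <#\<^bsub>G\<^esub> carrier A)"
    and dis: "carrier A \<inter> (x <#\<^bsub>G\<^esub> carrier A) = {}"
    using P unfolding index2_presentation_def by blast+
  have mult: "monoid.mult A = monoid.mult G" and one: "one A = one G"
    by (subst AG, simp)+
  have sG: "a \<in> carrier G" if "a \<in> carrier A" for a
    using that sub by (rule subgroup.mem_carrier[rotated])
  have m: "a \<otimes>\<^bsub>G\<^esub> b \<in> carrier A" if "a \<in> carrier A" "b \<in> carrier A" for a b
    using that A.m_closed mult by simp
  have fc: "f a \<in> carrier A" if "a \<in> carrier A" for a using f that by auto
  have \<phi>c: "\<phi> a \<in> carrier H" if "a \<in> carrier A" for a using \<phi> that by (auto simp: hom_def)
  have \<phi>m: "\<phi> (a \<otimes>\<^bsub>G\<^esub> b) = \<phi> a \<otimes>\<^bsub>H\<^esub> \<phi> b" if "a \<in> carrier A" "b \<in> carrier A" for a b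
    using \<phi> that mult by (auto simp: hom_def)
  have xa: "x \<otimes>\<^bsub>G\<^esub> a = f a \<otimes>\<^bsub>G\<^esub> x" if "a \<in> carrier A" for a
    using G.inv_solve_right[of "f a" "x \<otimes>\<^bsub>G\<^esub> a" x] xf[OF that] x sG[OF that] sG[OF fc[OF that]] by simp
  have ha: "h \<otimes>\<^bsub>H\<^esub> \<phi> a = \<phi> (f a) \<otimes>\<^bsub>H\<^esub> h" if "a \<in> carrier A" for a
    using H.inv_solve_right[of "\<phi> (f a)" "h \<otimes>\<^bsub>H\<^esub> \<phi> a" h] hf[OF that] h \<phi>c[OF that] \<phi>c[OF fc[OF that]]
    by simp
  have ff: "f (f a) = a" if a: "a \<in> carrier A" for a
  proof -
    have "y \<otimes>\<^bsub>G\<^esub> a = x \<otimes>\<^bsub>G\<^esub> (x \<otimes>\<^bsub>G\<^esub> a)" using x sG[OF a] xx G.m_assoc by metis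
    also have "\<dots> = f (f a) \<otimes>\<^bsub>G\<^esub> (x \<otimes>\<^bsub>G\<^esub> x)"
      using xa[OF a] xa[OF fc[OF a]] x sG[OF fc[OF a]] sG[OF fc[OF fc[OF a]]]
      by (metis G.m_assoc)
    finally have "y \<otimes>\<^bsub>G\<^esub> a = f (f a) \<otimes>\<^bsub>G\<^esub> y" using xx by simp
    moreover have "y \<otimes>\<^bsub>G\<^esub> a = a \<otimes>\<^bsub>G\<^esub> y" using A.m_comm[OF y a] mult by simp
    ultimately show ?thesis using G.r_cancel[of "f (f a)" y a] sG y a fc by metis
  qed
  have ax: "a \<otimes>\<^bsub>G\<^esub> x = x \<otimes>\<^bsub>G\<^esub> f a" if "a \<in> carrier A" for a
    using xa[OF fc[OF that]] ff[OF that] by simp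
  have ah: "\<phi> a \<otimes>\<^bsub>H\<^esub> h = h \<otimes>\<^bsub>H\<^esub> \<phi> (f a)" if "a \<in> carrier A" for a
    using ha[OF fc[OF that]] ff[OF that] by simp
  define \<psi> where "\<psi> g = (if g \<in> carrier A then \<phi> g else h \<otimes>\<^bsub>H\<^esub> \<phi> (inv\<^bsub>G\<^esub> x \<otimes>\<^bsub>G\<^esub> g))" for g
  have \<psi>A: "\<psi> a = \<phi> a" if "a \<in> carrier A" for a using that by (simp add: \<psi>_def)
  have \<psi>x: "\<psi> (x \<otimes>\<^bsub>G\<^esub> a) = h \<otimes>\<^bsub>H\<^esub> \<phi> a" if a: "a \<in> carrier A" for a
  proof -
    have "x \<otimes>\<^bsub>G\<^esub> a \<notin> carrier A" using dis a by (auto simp: l_coset_def)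
    moreover have "inv\<^bsub>G\<^esub> x \<otimes>\<^bsub>G\<^esub> (x \<otimes>\<^bsub>G\<^esub> a) = a"
      using x sG[OF a] by (metis G.inv_closed G.l_inv G.l_one G.m_assoc)
    ultimately show ?thesis by (simp add: \<psi>_def)
  qed
  have cases: "\<exists>a\<in>carrier A. g = a \<or> g = x \<otimes>\<^bsub>G\<^esub> a" if "g \<in> carrier G" for g
    using that GA by (auto simp: l_coset_def)
  have "\<psi> \<in> hom G H"
  proof (rule homI)
    fix g assume "g \<in> carrier G"
    with cases show "\<psi> g \<in> carrier H" using \<psi>A \<psi>x \<phi>c h by fastforce
  next
    fix g g' assume "g \<in> carrier G" "g' \<in> carrier G"
    then obtain a b where a: "a \<in> carrier A" and b: "b \<in> carrier A"
      and ga: "g = a \<or> g = x \<otimes>\<^bsub>G\<^esub> a" and gb: "g' = b \<or> g' = x \<otimes>\<^bsub>G\<^esub> b" using cases by meson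
    note c = a b fc[OF a] sG[OF a] sG[OF b] sG[OF fc[OF a]] x
    note d = h \<phi>c[OF a] \<phi>c[OF b] \<phi>c[OF fc[OF a]]
    have 1: "\<psi> (a \<otimes>\<^bsub>G\<^esub> b) = \<psi> a \<otimes>\<^bsub>H\<^esub> \<psi> b" using c by (simp add: \<psi>A m \<phi>m)
    have 2: "\<psi> ((x \<otimes>\<^bsub>G\<^esub> a) \<otimes>\<^bsub>G\<^esub> b) = \<psi> (x \<otimes>\<^bsub>G\<^esub> a) \<otimes>\<^bsub>H\<^esub> \<psi> b"
      using c d by (simp add: \<psi>A \<psi>x m \<phi>m G.m_assoc H.m_assoc)
    have e: "a \<otimes>\<^bsub>G\<^esub> (x \<otimes>\<^bsub>G\<^esub> b) = x \<otimes>\<^bsub>G\<^esub> (f a \<otimes>\<^bsub>G\<^esub> b)"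
      using c ax[OF a] by (metis G.m_assoc)
    have e': "\<phi> a \<otimes>\<^bsub>H\<^esub> (h \<otimes>\<^bsub>H\<^esub> \<phi> b) = h \<otimes>\<^bsub>H\<^esub> (\<phi> (f a) \<otimes>\<^bsub>H\<^esub> \<phi> b)"
      using d ah[OF a] by (metis H.m_assoc)
    have 3: "\<psi> (a \<otimes>\<^bsub>G\<^esub> (x \<otimes>\<^bsub>G\<^esub> b)) = \<psi> a \<otimes>\<^bsub>H\<^esub> \<psi> (x \<otimes>\<^bsub>G\<^esub> b)"
      using c by (simp add: e e' \<psi>A \<psi>x m \<phi>m)
    have e2: "(x \<otimes>\<^bsub>G\<^esub> a) \<otimes>\<^bsub>G\<^esub> (x \<otimes>\<^bsub>G\<^esub> b) = y \<otimes>\<^bsub>G\<^esub> (f a \<otimes>\<^bsub>G\<^esub> b)"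
      using c e xx by (metis G.m_assoc G.m_closed)
    have e2': "(h \<otimes>\<^bsub>H\<^esub> \<phi> a) \<otimes>\<^bsub>H\<^esub> (h \<otimes>\<^bsub>H\<^esub> \<phi> b) = \<phi> y \<otimes>\<^bsub>H\<^esub> (\<phi> (f a) \<otimes>\<^bsub>H\<^esub> \<phi> b)"
      using d e' hy by (metis H.m_assoc H.m_closed)
    have 4: "\<psi> ((x \<otimes>\<^bsub>G\<^esub> a) \<otimes>\<^bsub>G\<^esub> (x \<otimes>\<^bsub>G\<^esub> b)) = \<psi> (x \<otimes>\<^bsub>G\<^esub> a) \<otimes>\<^bsub>H\<^esub> \<psi> (x \<otimes>\<^bsub>G\<^esub> b)"
      using c y by (simp add: e2 e2' \<psi>A \<psi>x m \<phi>m)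
    show "\<psi> (g \<otimes>\<^bsub>G\<^esub> g') = \<psi> g \<otimes>\<^bsub>H\<^esub> \<psi> g'" using ga gb 1 2 3 4 by auto
  qed
  moreover have "\<psi> x = h"
  proof -
    have o: "\<one>\<^bsub>G\<^esub> \<in> carrier A" using A.one_closed one by simp
    have "\<phi> \<one>\<^bsub>G\<^esub> = \<one>\<^bsub>H\<^esub>" using hom_one[OF \<phi> A.is_group H] one by simp
    with \<psi>x[OF o] x h show ?thesis by simp
  qed
  ultimately show ?thesis using \<psi>A by blast
qed

lemma index2_presentation_exists:
  fixes A :: "'a monoid"
  assumes A: "comm_group A" and f: "f \<in> hom A A"
    and ff: "\<And>a. a \<in> carrier A \<Longrightarrow> f (f a) = a"
    and y: "y \<in> carrier A" and fy: "f y = y"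
  shows "\<exists>(G :: ('a \<times> bool) monoid) A' x.
           (\<lambda>a. (a, False)) \<in> iso A A' \<and>
           index2_presentation G A' (\<lambda>(a, b). (f a, b)) (y, False) x"
proof -
  interpret A: comm_group A by (rule A)
  have fc[simp]: "f a \<in> carrier A" if "a \<in> carrier A" for a using f that by (auto simp: hom_def)
  have fm[simp]: "f (a \<otimes>\<^bsub>A\<^esub> b) = f a \<otimes>\<^bsub>A\<^esub> f b" if "a \<in> carrier A" "b \<in> carrier A" for a b
    using f that by (auto simp: hom_def)
  have fo[simp]: "f \<one>\<^bsub>A\<^esub> = \<one>\<^bsub>A\<^esub>" using hom_one[OF f A.is_group A.is_group] .
  define G :: "('a \<times> bool) monoid" where "G = \<lparr>carrier = carrier A \<times> UNIV,
     monoid.mult = (\<lambda>(a, s) (b, t). (a \<otimes>\<^bsub>A\<^esub> (if s then f b else b) \<otimes>\<^bsub>A\<^esub> (if s \<and> t then y else \<one>\<^bsub>A\<^esub>), s \<noteq> t)),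
     one = (\<one>\<^bsub>A\<^esub>, False)\<rparr>"
  define K where "K = carrier A \<times> {False}"
  define A' where "A' = G\<lparr>carrier := K\<rparr>"
  define x where "x = (\<one>\<^bsub>A\<^esub>, True)"
  have Gs: "carrier G = carrier A \<times> UNIV" "\<one>\<^bsub>G\<^esub> = (\<one>\<^bsub>A\<^esub>, False)"
    "\<And>a s b t. (a, s) \<otimes>\<^bsub>G\<^esub> (b, t) =
       (a \<otimes>\<^bsub>A\<^esub> (if s then f b else b) \<otimes>\<^bsub>A\<^esub> (if s \<and> t then y else \<one>\<^bsub>A\<^esub>), s \<noteq> t)"
    by (simp_all add: G_def)
  have grp: "group G"
  proof (rule groupI)
    fix p q r assume "p \<in> carrier G" "q \<in> carrier G" "r \<in> carrier G"
    then show "p \<otimes>\<^bsub>G\<^esub> q \<otimes>\<^bsub>G\<^esub> r = p \<otimes>\<^bsub>G\<^esub> (q \<otimes>\<^bsub>G\<^esub> r)"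
      by (cases p; cases q; cases r) (auto simp: Gs y fy ff A.m_ac)
  next
    fix p assume "p \<in> carrier G"
    then obtain a s where p: "p = (a, s)" and a: "a \<in> carrier A" by (auto simp: Gs)
    show "\<exists>q\<in>carrier G. q \<otimes>\<^bsub>G\<^esub> p = \<one>\<^bsub>G\<^esub>"
    proof (cases s)
      case False
      then show ?thesis using p a by (intro bexI[of _ "(inv\<^bsub>A\<^esub> a, False)"]) (auto simp: Gs)
    next
      case True
      have "inv\<^bsub>A\<^esub> (f a \<otimes>\<^bsub>A\<^esub> y) \<otimes>\<^bsub>A\<^esub> f a \<otimes>\<^bsub>A\<^esub> y = \<one>\<^bsub>A\<^esub>"
        using a y by (subst A.m_assoc) auto
      then show ?thesis using p a True y
        by (intro bexI[of _ "(inv\<^bsub>A\<^esub> (f a \<otimes>\<^bsub>A\<^esub> y), True)"]) (auto simp: Gs)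
    qed
  qed (auto simp: Gs y)
  interpret G: group G by (rule grp)
  have invK: "inv\<^bsub>G\<^esub> (a, False) = (inv\<^bsub>A\<^esub> a, False)" if "a \<in> carrier A" for a
    by (rule G.inv_equality) (use that in \<open>auto simp: Gs\<close>)
  have sub: "subgroup K G"
    by (rule G.subgroupI) (auto simp: K_def Gs invK)
  have x: "x \<in> carrier G" by (simp add: x_def Gs)
  have xK: "x <#\<^bsub>G\<^esub> K = carrier A \<times> {True}"
  proof -
    have "(a, True) \<in> x <#\<^bsub>G\<^esub> K" if "a \<in> carrier A" for a
      using that by (auto simp: l_coset_def x_def K_def Gs ff intro!: bexI[of _ "f a"])
    then show ?thesis by (auto simp: l_coset_def x_def K_def Gs)
  qed
  have Kx: "K #>\<^bsub>G\<^esub> (a, s) = carrier A \<times> {s}" if a: "a \<in> carrier A" for a s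
  proof -
    have "(b, s) \<in> K #>\<^bsub>G\<^esub> (a, s)" if "b \<in> carrier A" for b
      using that a
      by (auto simp: r_coset_def K_def Gs A.m_assoc intro!: bexI[of _ "b \<otimes>\<^bsub>A\<^esub> inv\<^bsub>A\<^esub> a"])
    then have "carrier A \<times> {s} \<subseteq> K #>\<^bsub>G\<^esub> (a, s)" by blast
    moreover have "K #>\<^bsub>G\<^esub> (a, s) \<subseteq> carrier A \<times> {s}"
      using a by (auto simp: r_coset_def K_def Gs)
    ultimately show ?thesis by blast
  qed
  have "rcosets\<^bsub>G\<^esub> K = {carrier A \<times> {True}, carrier A \<times> {False}}"
  proof -
    have "rcosets\<^bsub>G\<^esub> K = (\<Union>s. {carrier A \<times> {s}})"
    proof -
      have "rcosets\<^bsub>G\<^esub> K = (\<Union>a\<in>carrier A. \<Union>s. {K #>\<^bsub>G\<^esub> (a, s)})"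
        unfolding RCOSETS_def Gs by blast
      also have "\<dots> = (\<Union>a\<in>carrier A. \<Union>s. {carrier A \<times> {s}})"
        by (simp add: Kx cong: SUP_cong)
      also have "\<dots> = (\<Union>s. {carrier A \<times> {s}})" using A.one_closed by blast
      finally show ?thesis .
    qed
    also have "\<dots> = {carrier A \<times> {True}, carrier A \<times> {False}}" by (auto simp: UNIV_bool)
    finally show ?thesis .
  qed
  moreover have "carrier A \<times> {True} \<noteq> carrier A \<times> {False}" using A.one_closed by blast
  ultimately have idx: "card (rcosets\<^bsub>G\<^esub> K) = 2" by simp
  have un: "carrier G = K \<union> (x <#\<^bsub>G\<^esub> K)" unfolding xK by (auto simp: K_def Gs)
  have dis: "K \<inter> (x <#\<^bsub>G\<^esub> K) = {}" unfolding xK by (auto simp: K_def)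
  have xx: "x \<otimes>\<^bsub>G\<^esub> x = (y, False)" using y by (simp add: x_def Gs)
  have gen: "generate G (K \<union> {x}) = carrier G"
  proof
    show "generate G (K \<union> {x}) \<subseteq> carrier G"
      using sub x by (intro G.generate_incl) (auto simp: K_def Gs)
    show "carrier G \<subseteq> generate G (K \<union> {x})"
      unfolding un l_coset_def by (blast intro: generate.incl generate.eng)
  qed
  have conj: "x \<otimes>\<^bsub>G\<^esub> p \<otimes>\<^bsub>G\<^esub> inv\<^bsub>G\<^esub> x = (case p of (a, b) \<Rightarrow> (f a, b))" if p: "p \<in> K" for p
  proof -
    have pc: "p \<in> carrier G" using p sub subgroup.subset by blast
    have "(case p of (a, b) \<Rightarrow> (f a, b)) \<in> carrier G" using p by (auto simp: K_def Gs)
    moreover have "x \<otimes>\<^bsub>G\<^esub> p = (case p of (a, b) \<Rightarrow> (f a, b)) \<otimes>\<^bsub>G\<^esub> x"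
      using p by (auto simp: K_def x_def Gs)
    ultimately show ?thesis using x pc by (metis G.inv_solve_right G.m_closed)
  qed
  have "index2_presentation G A' (\<lambda>(a, b). (f a, b)) (y, False) x"
    unfolding index2_presentation_def A'_def
    using grp sub x gen conj idx un dis xx by simp
  moreover have "(\<lambda>a. (a, False)) \<in> iso A A'"
    by (auto simp: iso_def hom_def A'_def K_def Gs bij_betw_def inj_on_def)
  ultimately show ?thesis by blast
qed

end

theory Submission
  imports Defs "Jordan_Normal_Form.Char_Poly"
begin

text \<open>
  The Hermitian adjacency matrix is right convolution by a function on \<open>G\<close>, so it commutes with left
  translation by \<open>A\<close>, and every eigenspace contains some \<open>v \<noteq> 0\<close> with \<open>v (a g) = \<pi> a * v g\<close> for a
  character \<open>\<pi>\<close> of \<open>A\<close>. Such a \<open>v\<close> is determined by \<open>v 1\<close> and \<open>v x\<close>, on which the matrix acts as a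
  \<open>2 \<times> 2\<close> block with trace \<open>\<delta> \<pi>\<close> and determinant \<open>\<epsilon> \<pi>\<close>. If \<open>B \<subseteq> ker \<pi>\<close>, then \<open>\<pi>\<close> extends to \<open>G\<close> in two
  ways, by the square roots of \<open>\<pi> y\<close>, and these extensions are the eigenvectors. Otherwise the
  eigenvalues of the block are \<open>(\<delta> \<plusminus> \<zeta>) / 2\<close>; when \<open>\<delta>\<close> and \<open>\<zeta>\<close> are integers these are
  rational, hence integers, being eigenvalues of a matrix with Gaussian integer entries.
\<close>

section \<open>Rational eigenvalues of integer and Gaussian integer matrices\<close>

text \<open>The characteristic polynomial is monic with integer coefficients, so \<open>k\<close> is
  an algebraic integer, and a rational algebraic integer is an integer. Enumerating \<open>V\<close>
  only transports the sum to the matrix type.\<close>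

lemma rational_eigenvalue_int_matrix:
  fixes N :: "'v \<Rightarrow> 'v \<Rightarrow> int" and u :: "'v \<Rightarrow> real"
  assumes fin: "finite V" and nz: "\<exists>g\<in>V. u g \<noteq> 0"
    and eig: "\<forall>g\<in>V. (\<Sum>h\<in>V. of_int (N g h) * u h) = k * u g" and rat: "k \<in> \<rat>"
  shows "k \<in> \<int>"
proof -
  define n where "n = card V"
  obtain e where e: "bij_betw e {0..<n} V"
    using ex_bij_betw_nat_finite[OF fin] unfolding n_def by blast
  define M where "M = mat n n (\<lambda>(i, j). N (e i) (e j))"
  define v where "v = vec n (\<lambda>i. u (e i))"
  have M: "M \<in> carrier_mat n n" by (simp add: M_def)
  have eV: "e i \<in> V" if "i < n" for i using e that by (auto simp: bij_betw_def)
  have "map_mat real_of_int M *\<^sub>v v = k \<cdot>\<^sub>v v"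
  proof (rule eq_vecI)
    fix i assume "i < dim_vec (k \<cdot>\<^sub>v v)"
    then have i: "i < n" by (simp add: v_def)
    have "(map_mat real_of_int M *\<^sub>v v) $ i = (\<Sum>j\<in>{0..<n}. of_int (N (e i) (e j)) * u (e j))"
      using i by (auto simp: M_def v_def scalar_prod_def intro!: sum.cong)
    also have "\<dots> = (\<Sum>h\<in>V. of_int (N (e i) h) * u h)"
      by (rule sum.reindex_bij_betw[OF e])
    also have "\<dots> = (k \<cdot>\<^sub>v v) $ i" using eig eV[OF i] i by (simp add: v_def)
    finally show "(map_mat real_of_int M *\<^sub>v v) $ i = (k \<cdot>\<^sub>v v) $ i" .
  qed (simp add: M_def v_def)
  moreover have "v \<noteq> 0\<^sub>v n"
  proof
    assume v0: "v = 0\<^sub>v n"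
    obtain g where g: "g \<in> V" "u g \<noteq> 0" using nz by blast
    then obtain i where i: "i < n" "g = e i" using e by (auto simp: bij_betw_def)
    then have "u g = v $ i" by (simp add: v_def)
    with v0 i g show False by simp
  qed
  moreover have "v \<in> carrier_vec n" by (simp add: v_def)
  ultimately have "eigenvalue (map_mat real_of_int M) k"
    unfolding eigenvalue_def eigenvector_def using M by auto
  moreover have "char_poly (map_mat real_of_int M) = map_poly real_of_int (char_poly M)"
    by (rule of_int_hom.char_poly_hom[OF M])
  ultimately have root: "poly (map_poly real_of_int (char_poly M)) k = 0"
    using eigenvalue_root_char_poly[of "map_mat real_of_int M" n] M by simp
  have "algebraic_int k"
    unfolding algebraic_int_altdef_ipoly
    using root degree_monic_char_poly[OF M] by auto
  then show ?thesis using rat by (rule rational_algebraic_int_is_int)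
qed

text \<open>Passing to real and imaginary parts gives an integer matrix of twice the size. A
  rational \<open>k\<close> is real, so it scales both parts separately and stays an
  eigenvalue.\<close>

lemma rational_eigenvalue_gaussian_int_matrix:
  assumes fin: "finite V" and eig: "matrix_eigenvalue V M k"
    and int: "\<And>g h. g \<in> V \<Longrightarrow> h \<in> V \<Longrightarrow> Re (M g h) \<in> \<int> \<and> Im (M g h) \<in> \<int>"
    and rat: "k \<in> \<rat>"
  shows "k \<in> \<int>"
proof -
  obtain v g0 where g0: "g0 \<in> V" "v g0 \<noteq> 0"
    and v: "\<And>g. g \<in> V \<Longrightarrow> (\<Sum>h\<in>V. M g h * v h) = k * v g"
    using eig unfolding matrix_eigenvalue_def by blast
  obtain a b where "k = of_int a / of_int b" using rat by (auto elim: Rats_cases')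
  then obtain r where k: "k = complex_of_real r" and r: "r \<in> \<rat>"
    by (metis of_real_divide of_real_of_int_eq Rats_divide Rats_of_int)
  \<comment> \<open>The index \<open>(g, True)\<close> holds the imaginary part at \<open>g\<close>
    and \<open>(g, False)\<close> the real part. The floors are exact because the parts are
    integers.\<close>
  define N where "N = (\<lambda>(g, b) (h, c).
    if b = c then \<lfloor>Re (M g h)\<rfloor> else if b then \<lfloor>Im (M g h)\<rfloor> else - \<lfloor>Im (M g h)\<rfloor>)"
  define u where "u = (\<lambda>(g, b). if b then Im (v g) else Re (v g))"
  have "(\<Sum>p\<in>V \<times> UNIV. of_int (N (g, b) p) * u p) = r * u (g, b)" if g: "g \<in> V" for g b
  proof -
    have int': "of_int \<lfloor>Re (M g h)\<rfloor> = Re (M g h)" "of_int \<lfloor>Im (M g h)\<rfloor> = Im (M g h)"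
      if "h \<in> V" for h using int[OF g that] by (auto elim!: Ints_cases)
    have "(\<Sum>p\<in>V \<times> UNIV. of_int (N (g, b) p) * u p)
        = (\<Sum>h\<in>V. \<Sum>c\<in>UNIV. of_int (N (g, b) (h, c)) * u (h, c))"
      by (simp add: sum.cartesian_product)
    also have "\<dots> = (\<Sum>h\<in>V. if b then Im (M g h * v h) else Re (M g h * v h))"
      by (rule sum.cong) (auto simp: UNIV_bool N_def u_def int')
    also have "\<dots> = (if b then Im (\<Sum>h\<in>V. M g h * v h) else Re (\<Sum>h\<in>V. M g h * v h))"
      by (simp add: Re_sum Im_sum)
    also have "\<dots> = r * u (g, b)" by (simp add: v[OF g] k u_def)
    finally show ?thesis .
  qed
  moreover have "\<exists>p\<in>V \<times> UNIV. u p \<noteq> 0"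
    using g0 by (auto simp: u_def complex_eq_iff intro: bexI[of _ "(g0, _)"])
  ultimately have "r \<in> \<int>"
    using fin by (intro rational_eigenvalue_int_matrix[of "V \<times> UNIV" u N r]) (auto simp: r)
  then show ?thesis using k by (auto elim!: Ints_cases)
qed

section \<open>Simultaneous eigenvectors of commuting translations\<close>

text \<open>Translations have finite order, so a discrete Fourier projection splits a vector into
  eigenvectors of one translation. Projecting for one element of \<open>H\<close> at a time
  preserves the eigenvector properties already gained, because the elements commute. Both closure
  assumptions on \<open>E\<close> are what keeps the projections inside \<open>E\<close>.\<close>

lemma (in group) common_translation_eigenvector:
  fixes E :: "('a \<Rightarrow> complex) set"
  assumes fin: "finite (carrier G)" and H: "H \<subseteq> carrier G"
    and comm: "\<And>a b. a \<in> H \<Longrightarrow> b \<in> H \<Longrightarrow> a \<otimes> b = b \<otimes> a"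
    and lin: "\<And>n c w. (\<And>j. w j \<in> E) \<Longrightarrow> (\<lambda>g. \<Sum>j<n::nat. c j * w j g) \<in> E"
    and trans: "\<And>a w. a \<in> carrier G \<Longrightarrow> w \<in> E \<Longrightarrow> (\<lambda>g. w (a \<otimes> g)) \<in> E"
    and ex: "\<exists>v\<in>E. \<exists>g\<in>carrier G. v g \<noteq> 0"
  shows "\<exists>v\<in>E. (\<exists>g\<in>carrier G. v g \<noteq> 0) \<and>
    (\<forall>a\<in>H. \<exists>c. \<forall>g\<in>carrier G. v (a \<otimes> g) = c * v g)"
proof -
  have "finite H" using fin H finite_subset by blast
  then show ?thesis using H comm
  proof (induction H rule: finite_induct)
    case empty
    then show ?case using ex by simp
  next
    case (insert a F)
    then obtain w g0 where wE: "w \<in> E" and g0: "g0 \<in> carrier G" "w g0 \<noteq> 0"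
      and w: "\<And>b. b \<in> F \<Longrightarrow> \<exists>c. \<forall>g\<in>carrier G. w (b \<otimes> g) = c * w g"
      by (metis insertCI insert_subset)
    have a: "a \<in> carrier G" using insert.prems by simp
    define n where "n = card (carrier G)"
    have n: "n > 0" using fin by (auto simp: n_def card_gt_0_iff)
    have an: "a [^] n = \<one>" using a pow_order_eq_1 by (simp add: n_def Coset.order_def)
    \<comment> \<open>A primitive \<open>n\<close>-th root of unity for the order \<open>n\<close>
      of the group; the order of \<open>a\<close> divides \<open>n\<close>, so all eigenvalues of
      translation by \<open>a\<close> are powers of \<open>z\<close>.\<close>
    define z where "z = cis (2 * pi / n)"
    have zpow: "z ^ j = cis (2 * pi * j / n)" for j :: nat
      by (simp add: z_def DeMoivre mult.commute)
    have zn: "z ^ n = 1" using n by (simp add: zpow)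
    have zj: "z ^ j \<noteq> 1" if "0 < j" "j < n" for j
      using bij_betw_roots_unity[OF n] that n
      by (auto simp: bij_betw_def zpow dest!: inj_onD[where x = j and y = 0])
    \<comment> \<open>Up to the factor \<open>n\<close>, the projection of \<open>w\<close> onto the
      eigenspace of translation by \<open>a\<close> with eigenvalue
      \<open>inverse (z ^ m)\<close>.\<close>
    define u where "u m = (\<lambda>g. \<Sum>j<n. z ^ (m * j) * w (a [^] j \<otimes> g))" for m
    \<comment> \<open>The projections add up to a multiple of \<open>w\<close>, since the geometric
      sums vanish for \<open>j \<noteq> 0\<close>. Hence one of them is nonzero at
      \<open>g0\<close>.\<close>
    have "(\<Sum>m<n. u m g0) = of_nat n * w g0"
    proof -
      have "(\<Sum>m<n. u m g0) = (\<Sum>j<n. (\<Sum>m<n. (z ^ j) ^ m) * w (a [^] j \<otimes> g0))"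
        unfolding u_def
        by (subst sum.swap) (simp add: sum_distrib_right power_mult[symmetric] mult.commute[where 'a = nat])
      also have "\<dots> = (\<Sum>j<n. if j = 0 then of_nat n * w g0 else 0)"
      proof (rule sum.cong)
        fix j assume j: "j \<in> {..<n}"
        have "(\<Sum>m<n. (z ^ j) ^ m) = 0" if "j \<noteq> 0"
          using zj[of j] j that geometric_sum[of "z ^ j" n]
          by (simp add: power_mult[symmetric] mult.commute[of j n]) (simp add: power_mult zn)
        then show "(\<Sum>m<n. (z ^ j) ^ m) * w (a [^] j \<otimes> g0) = (if j = 0 then of_nat n * w g0 else 0)"
          using g0 by simp
      qed simp
      finally show ?thesis using n by simp
    qed
    then obtain m where m: "u m g0 \<noteq> 0"
      using n g0 by (metis (no_types, lifting) mult_eq_0_iff of_nat_eq_0_iff sum.neutral less_irrefl)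
    have "u m \<in> E"
      unfolding u_def by (intro lin trans wE) (simp add: a)
    moreover have "\<exists>c. \<forall>g\<in>carrier G. u m (b \<otimes> g) = c * u m g" if b: "b \<in> insert a F" for b
    proof (cases "b = a")
      case True
      \<comment> \<open>Translation shifts the summation index by one; the term \<open>F n\<close>
        that enters equals the term \<open>F 0\<close> that leaves, by \<open>z ^ n = 1\<close> and
        \<open>a [^] n = \<one>\<close>.\<close>
      have "z ^ m * u m (a \<otimes> g) = u m g" if g: "g \<in> carrier G" for g
      proof -
        define F where "F j = z ^ (m * j) * w (a [^] j \<otimes> g)" for j
        have "z ^ m * u m (a \<otimes> g) = (\<Sum>j<n. F (Suc j))"
          unfolding u_def F_def sum_distrib_left
          using a g by (intro sum.cong) (simp_all add: power_add m_assoc)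
        also have "\<dots> = (\<Sum>j<Suc n. F j) - F 0"
          by (subst sum.lessThan_Suc_shift) simp
        also have "\<dots> = (\<Sum>j<n. F j)"
          using zn by (simp add: F_def an mult.commute[of m n]) (simp add: power_mult)
        finally show ?thesis by (simp add: u_def F_def)
      qed
      then have "\<forall>g\<in>carrier G. u m (a \<otimes> g) = inverse (z ^ m) * u m g"
        by (simp add: field_simps z_def)
      then show ?thesis using True by blast
    next
      case False
      with b have bF: "b \<in> F" by simp
      then obtain c where c: "\<And>g. g \<in> carrier G \<Longrightarrow> w (b \<otimes> g) = c * w g" using w by blast
      have bG: "b \<in> carrier G" using insert.prems bF by auto
      have "a \<otimes> b = b \<otimes> a" using insert.prems(2) bF by simp
      then have ab: "a [^] j \<otimes> b = b \<otimes> a [^] j" for j :: nat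
        using a bG by (simp add: pow_mult_distrib group_commutes_pow)
      have "u m (b \<otimes> g) = c * u m g" if g: "g \<in> carrier G" for g
      proof -
        have "w (a [^] j \<otimes> (b \<otimes> g)) = c * w (a [^] j \<otimes> g)" for j :: nat
          using c[of "a [^] j \<otimes> g"] ab[of j] a bG g by (metis m_assoc m_closed nat_pow_closed)
        then show ?thesis by (simp add: u_def sum_distrib_left mult.left_commute)
      qed
      then show ?thesis by blast
    qed
    ultimately show ?case using m g0 by blast
  qed
qed

section \<open>Characters with nonzero complex values\<close>

lemma comm_group_complex_units: "comm_group complex_units"
proof (rule comm_groupI)
  fix z assume "z \<in> carrier complex_units"
  then show "\<exists>u\<in>carrier complex_units. u \<otimes>\<^bsub>complex_units\<^esub> z = \<one>\<^bsub>complex_units\<^esub>"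
    by (intro bexI[of _ "inverse z"]) (auto simp: complex_units_def)
qed (auto simp: complex_units_def)

lemma (in group) hom_complex_unitsD:
  assumes \<rho>: "\<rho> \<in> hom G complex_units"
  shows "g \<in> carrier G \<Longrightarrow> \<rho> g \<noteq> 0"
    and "g \<in> carrier G \<Longrightarrow> h \<in> carrier G \<Longrightarrow> \<rho> (g \<otimes> h) = \<rho> g * \<rho> h"
    and "\<rho> \<one> = 1"
proof -
  show nz: "\<rho> g \<noteq> 0" if "g \<in> carrier G" for g
    using \<rho> that by (auto simp: hom_def complex_units_def)
  show m: "\<rho> (g \<otimes> h) = \<rho> g * \<rho> h" if "g \<in> carrier G" "h \<in> carrier G" for g h
    using \<rho> that by (auto simp: hom_def complex_units_def)
  show "\<rho> \<one> = 1" using m[of \<one> \<one>] nz[of \<one>] by simp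
qed

text \<open>Character values on a finite group are roots of unity, hence of modulus 1, where inverse
  and conjugate agree.\<close>

lemma (in group) hom_complex_units_inv:
  assumes fin: "finite (carrier G)" and \<rho>: "\<rho> \<in> hom G complex_units" and a: "a \<in> carrier G"
  shows "\<rho> (inv a) = cnj (\<rho> a)"
proof -
  note nz = hom_complex_unitsD(1)[OF \<rho>] and m = hom_complex_unitsD(2)[OF \<rho>]
    and one = hom_complex_unitsD(3)[OF \<rho>]
  have "\<rho> (a [^] n) = \<rho> a ^ n" for n :: nat
    by (induction n) (use a m one in \<open>auto simp: mult.commute\<close>)
  then have "\<rho> a ^ card (carrier G) = 1"
    using pow_order_eq_1[OF a] one by (metis Coset.order_def)
  then have "cmod (\<rho> a) = 1"
    using power_eq_1_iff[of "\<rho> a"] fin one_closed by (metis card_0_eq empty_iff)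
  then have "\<rho> a * cnj (\<rho> a) = 1" by (simp add: complex_norm_square[symmetric])
  moreover have "\<rho> a * \<rho> (inv a) = 1" using m[of a "inv a"] a one by simp
  ultimately show ?thesis using nz[OF a] by (metis mult_left_cancel)
qed

section \<open>Eigenvalues of two by two matrices\<close>

lemma eigenvalue_2x2_iff:
  fixes k P Q R U :: "'k :: field"
  shows "(\<exists>p q. (p \<noteq> 0 \<or> q \<noteq> 0) \<and> P * p + R * q = k * p \<and> U * p + Q * q = k * q)
    \<longleftrightarrow> (k - P) * (k - Q) = R * U"
proof
  assume "\<exists>p q. (p \<noteq> 0 \<or> q \<noteq> 0) \<and> P * p + R * q = k * p \<and> U * p + Q * q = k * q"
  then obtain p q where pq: "p \<noteq> 0 \<or> q \<noteq> 0"
    and 1: "R * q = (k - P) * p" and 2: "U * p = (k - Q) * q"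
    by (auto simp: algebra_simps)
  have "(k - P) * (k - Q) * p = R * U * p" "(k - P) * (k - Q) * q = R * U * q"
    using 1 2 by (metis mult.assoc mult.commute)+
  with pq show "(k - P) * (k - Q) = R * U" by auto
next
  assume *: "(k - P) * (k - Q) = R * U"
  show "\<exists>p q. (p \<noteq> 0 \<or> q \<noteq> 0) \<and> P * p + R * q = k * p \<and> U * p + Q * q = k * q"
  proof (cases "R = 0 \<and> k = P")
    case False
    \<comment> \<open>\<open>(R, k - P)\<close> solves the first equation identically and the second
      by the determinant condition; it is nonzero in this case.\<close>
    then show ?thesis using *
      by (intro exI[of _ R] exI[of _ "k - P"]) (auto simp: algebra_simps)
  next
    case True
    show ?thesis
    proof (cases "k = Q \<and> U = 0")
      case False
      \<comment> \<open>Likewise \<open>(k - Q, U)\<close>, with the two equations exchanged. If it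
        vanishes too, the matrix is \<open>k\<close> times the identity and any vector
        serves.\<close>
      then show ?thesis using True
        by (intro exI[of _ "k - Q"] exI[of _ U]) (auto simp: algebra_simps)
    next
      case True
      then show ?thesis using \<open>R = 0 \<and> k = P\<close>
        by (intro exI[of _ 1] exI[of _ 0]) auto
    qed
  qed
qed

text \<open>The roots are half of trace plus or minus a square root of the discriminant. Integer
  roots have integer sum and difference, which gives one direction. Conversely the roots are only
  seen to be halves of integers, and \<open>rat\<close> replaces a parity argument.\<close>

lemma integer_roots_iff:
  fixes P Q R U :: complex
  assumes rat: "\<And>k. (k - P) * (k - Q) = R * U \<Longrightarrow> k \<in> \<rat> \<Longrightarrow> k \<in> \<int>"
  shows "(\<forall>k. (k - P) * (k - Q) = R * U \<longrightarrow> k \<in> \<int>) \<longleftrightarrow>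
    P + Q \<in> \<int> \<and> (\<exists>\<zeta>::int. (P + Q)\<^sup>2 - 4 * (P * Q - R * U) = (of_int \<zeta>)\<^sup>2)"
proof
  assume *: "\<forall>k. (k - P) * (k - Q) = R * U \<longrightarrow> k \<in> \<int>"
  define d where "d = csqrt ((P + Q)\<^sup>2 - 4 * (P * Q - R * U))"
  have d: "d\<^sup>2 = (P + Q)\<^sup>2 - 4 * (P * Q - R * U)" by (simp add: d_def)
  have "((P + Q + d) / 2 - P) * ((P + Q + d) / 2 - Q) = R * U"
    "((P + Q - d) / 2 - P) * ((P + Q - d) / 2 - Q) = R * U"
    using d by (simp_all add: field_simps power2_eq_square)
  then have k: "(P + Q + d) / 2 \<in> \<int>" "(P + Q - d) / 2 \<in> \<int>" using * by blast+
  have "(P + Q + d) / 2 + (P + Q - d) / 2 = P + Q" "(P + Q + d) / 2 - (P + Q - d) / 2 = d"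
    by (simp_all add: field_simps)
  then have "P + Q \<in> \<int>" "d \<in> \<int>" using Ints_add[OF k] Ints_diff[OF k] by simp_all
  then show "P + Q \<in> \<int> \<and> (\<exists>\<zeta>::int. (P + Q)\<^sup>2 - 4 * (P * Q - R * U) = (of_int \<zeta>)\<^sup>2)"
    using d by (metis Ints_cases)
next
  assume *: "P + Q \<in> \<int> \<and> (\<exists>\<zeta>::int. (P + Q)\<^sup>2 - 4 * (P * Q - R * U) = (of_int \<zeta>)\<^sup>2)"
  then obtain \<zeta> :: int where \<zeta>: "(P + Q)\<^sup>2 - 4 * (P * Q - R * U) = (of_int \<zeta>)\<^sup>2" by blast
  show "\<forall>k. (k - P) * (k - Q) = R * U \<longrightarrow> k \<in> \<int>"
  proof (intro allI impI)
    fix k assume k: "(k - P) * (k - Q) = R * U"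
    have "(2 * k - (P + Q))\<^sup>2 = (of_int \<zeta>)\<^sup>2"
      unfolding \<zeta>[symmetric] k[symmetric] by (simp add: algebra_simps power2_eq_square)
    then have "2 * k - (P + Q) = of_int \<zeta> \<or> 2 * k - (P + Q) = - of_int \<zeta>"
      by (simp add: power2_eq_iff)
    then have "k = (P + Q + of_int \<zeta>) / 2 \<or> k = (P + Q - of_int \<zeta>) / 2"
      by (auto simp: field_simps)
    moreover have "P + Q \<in> \<rat>" using * Ints_subset_Rats by blast
    then have "(P + Q + of_int \<zeta>) / 2 \<in> \<rat>" "(P + Q - of_int \<zeta>) / 2 \<in> \<rat>"
      by (simp_all only: Rats_divide Rats_add Rats_diff Rats_of_int Rats_number_of)
    ultimately have "k \<in> \<rat>" by metis
    with rat k show "k \<in> \<int>" by blast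
  qed
qed

section \<open>Arithmetic in the index two extension of A\<close>

locale index2_extension = group G for G :: "'a monoid" (structure) +
  fixes A :: "'a monoid" and f :: "'a \<Rightarrow> 'a" and x y :: 'a
  assumes comm_A: "comm_group A" and finite_A: "finite (carrier A)"
    and f_hom: "f \<in> hom A A" and y_A: "y \<in> carrier A"
    and presentation: "index2_presentation G A f y x"
begin

sublocale A: comm_group A by (rule comm_A)

lemma subgroup_A: "subgroup (carrier A) G"
  and x_closed [simp]: "x \<in> carrier G" and x_mult_x: "x \<otimes> x = y"
  and conj_x: "a \<in> carrier A \<Longrightarrow> x \<otimes> a \<otimes> inv x = f a"
  and carrier_G_l_coset: "carrier G = carrier A \<union> (x <# carrier A)"
  and disjoint_l_coset: "carrier A \<inter> (x <# carrier A) = {}"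
  using presentation unfolding index2_presentation_def by blast+

lemma A_eq: "A = G\<lparr>carrier := carrier A\<rparr>"
  using presentation unfolding index2_presentation_def by blast

lemma mult_A [simp]: "a \<otimes>\<^bsub>A\<^esub> b = a \<otimes> b" and one_A [simp]: "\<one>\<^bsub>A\<^esub> = \<one>"
  by (subst A_eq, simp)+

lemma A_closed [simp]: "a \<in> carrier A \<Longrightarrow> a \<in> carrier G"
  using subgroup.mem_carrier[OF subgroup_A] .

lemma m_inv_A [simp]: "a \<in> carrier A \<Longrightarrow> inv\<^bsub>A\<^esub> a = inv a"
  using m_inv_consistent[OF subgroup_A] A_eq by metis

lemma A_m_closed [simp]: "a \<in> carrier A \<Longrightarrow> b \<in> carrier A \<Longrightarrow> a \<otimes> b \<in> carrier A"
  using A.m_closed by simp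

lemma A_inv_closed [simp]: "a \<in> carrier A \<Longrightarrow> inv a \<in> carrier A"
  using A.inv_closed by fastforce

lemma A_one_closed [simp]: "\<one> \<in> carrier A"
  using A.one_closed by simp

lemma A_comm: "a \<in> carrier A \<Longrightarrow> b \<in> carrier A \<Longrightarrow> a \<otimes> b = b \<otimes> a"
  using A.m_comm by simp

lemma f_closed [simp]: "a \<in> carrier A \<Longrightarrow> f a \<in> carrier A"
  using f_hom by (auto simp: hom_def)

lemma f_mult [simp]: "a \<in> carrier A \<Longrightarrow> b \<in> carrier A \<Longrightarrow> f (a \<otimes> b) = f a \<otimes> f b"
  using f_hom by (auto simp: hom_def)

lemma f_inv [simp]: "a \<in> carrier A \<Longrightarrow> f (inv a) = inv (f a)"
  using group_hom.hom_inv[of A A f a] f_hom A.is_group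
  by (simp add: group_hom_def group_hom_axioms_def)

lemma x_mult: "a \<in> carrier A \<Longrightarrow> x \<otimes> a = f a \<otimes> x"
  using inv_solve_right[of "f a" "x \<otimes> a" x] conj_x by simp

text \<open>Applying \<open>f\<close> twice is conjugation by \<open>x \<otimes> x = y\<close>,
  which is trivial because A is abelian and contains \<open>y\<close>.\<close>

lemma f_f [simp]:
  assumes a: "a \<in> carrier A" shows "f (f a) = a"
proof -
  have "y \<otimes> a = f (f a) \<otimes> y"
    using a x_mult[of a] x_mult[of "f a"] x_mult_x
    by (metis A_closed f_closed m_assoc x_closed)
  then show ?thesis using A_comm[of y a] a y_A r_cancel[of "f (f a)" y a] by simp
qed

lemma f_y [simp]: "f y = y"
proof -
  have "f y \<otimes> x = y \<otimes> x" using x_mult[OF y_A] x_mult_x by (metis m_assoc x_closed)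
  then show ?thesis using y_A by simp
qed

lemma inj_on_f: "inj_on f (carrier A)"
  by (rule inj_onI) (metis f_f)

lemma x_mult_notin_A: "a \<in> carrier A \<Longrightarrow> x \<otimes> a \<notin> carrier A"
  using disjoint_l_coset by (auto simp: l_coset_def)

lemma mult_x_notin_A: "a \<in> carrier A \<Longrightarrow> a \<otimes> x \<notin> carrier A"
  using x_mult[of "f a"] x_mult_notin_A[of "f a"] by simp

text \<open>Puts inverses in the nontrivial coset back into the form \<open>x \<otimes> b\<close>,
  the form in which \<open>S2\<close> and \<open>T2\<close> record that coset.\<close>

lemma inv_x_mult:
  assumes a: "a \<in> carrier A"
  shows "inv (x \<otimes> a) = x \<otimes> (inv y \<otimes> inv (f a))"
proof (rule inv_equality)
  have "x \<otimes> (inv y \<otimes> inv (f a)) \<otimes> (x \<otimes> a) = x \<otimes> (inv y \<otimes> inv (f a)) \<otimes> (f a \<otimes> x)"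
    using x_mult[OF a] by simp
  also have "\<dots> = x \<otimes> inv y \<otimes> x" 
    using a y_A by (simp add: m_assoc inv_solve_left')
  also have "\<dots> = f (inv y) \<otimes> (x \<otimes> x)"
    using x_mult[of "inv y"] y_A by (simp add: m_assoc)
  also have "\<dots> = \<one>" using y_A x_mult_x by simp
  finally show "x \<otimes> (inv y \<otimes> inv (f a)) \<otimes> (x \<otimes> a) = \<one>" .
qed (use a y_A in simp_all)

text \<open>Here the coset is written with A on the left, to suit functions that transform under
  left translation by A; sums over G use \<open>x \<otimes> a\<close> instead, to suit the splitting
  of \<open>S\<close>.\<close>

lemma carrier_G_cases:
  assumes "g \<in> carrier G"
  obtains a where "a \<in> carrier A" "g = a" | a where "a \<in> carrier A" "g = a \<otimes> x"
  using assms carrier_G_l_coset x_mult f_closed unfolding l_coset_def by fastforce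

lemma finite_G: "finite (carrier G)"
  using carrier_G_l_coset finite_A by (simp add: l_coset_def)

lemma sum_carrier_G: "sum F (carrier G) = (\<Sum>a\<in>carrier A. F a) + (\<Sum>a\<in>carrier A. F (x \<otimes> a))"
proof -
  have "x <# carrier A = (\<lambda>a. x \<otimes> a) ` carrier A" by (auto simp: l_coset_def)
  moreover have "inj_on (\<lambda>a. x \<otimes> a) (carrier A)" by (auto intro: inj_onI)
  ultimately have "sum F (x <# carrier A) = (\<Sum>a\<in>carrier A. F (x \<otimes> a))"
    by (simp add: sum.reindex)
  then show ?thesis
    using finite_A disjoint_l_coset carrier_G_l_coset
    by (subst carrier_G_l_coset, subst sum.union_disjoint) (auto simp: l_coset_def)
qed

section \<open>Convolution operators and their blocks\<close>

lemma sum_convolution: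
  assumes g: "g \<in> carrier G"
  shows "(\<Sum>h\<in>carrier G. w (inv g \<otimes> h) * v h) = (\<Sum>s\<in>carrier G. w s * v (g \<otimes> s))"
  by (rule sum.reindex_bij_witness[where i = "\<lambda>s. g \<otimes> s" and j = "\<lambda>h. inv g \<otimes> h"])
    (use g in \<open>auto simp: m_assoc[symmetric]\<close>)

text \<open>An equivariant \<open>v\<close> is determined by \<open>v \<one>\<close> and
  \<open>v x\<close>. Moving \<open>x\<close> to the right past \<open>a\<close> turns
  \<open>\<pi> a\<close> into \<open>\<pi> (f a)\<close>, and two factors \<open>x\<close> merge
  into \<open>y\<close>; this produces the four entries of the block.\<close>

lemma convolution_equivariant:
  fixes w v \<pi> :: "'a \<Rightarrow> complex"
  assumes v: "\<And>a g. a \<in> carrier A \<Longrightarrow> g \<in> carrier G \<Longrightarrow> v (a \<otimes> g) = \<pi> a * v g"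
    and b: "b \<in> carrier A"
  shows "(\<Sum>h\<in>carrier G. w (inv b \<otimes> h) * v h) =
      \<pi> b * ((\<Sum>a\<in>carrier A. w a * \<pi> a) * v \<one> + (\<Sum>a\<in>carrier A. w (x \<otimes> a) * \<pi> (f a)) * v x)" (is ?A)
    and "(\<Sum>h\<in>carrier G. w (inv (b \<otimes> x) \<otimes> h) * v h) =
      \<pi> b * ((\<Sum>a\<in>carrier A. w (x \<otimes> a) * \<pi> (y \<otimes> a)) * v \<one> + (\<Sum>a\<in>carrier A. w a * \<pi> (f a)) * v x)" (is ?B)
proof -
  have 1: "v (b \<otimes> a) = \<pi> b * (\<pi> a * v \<one>)" if "a \<in> carrier A" for a
    using v[OF b, of a] v[OF that, of \<one>] that by simp
  have 2: "v (b \<otimes> (x \<otimes> a)) = \<pi> b * (\<pi> (f a) * v x)" if "a \<in> carrier A" for a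
    using v[OF b, of "x \<otimes> a"] v[of "f a" x] that x_mult[OF that] by simp
  have 3: "v (b \<otimes> x \<otimes> a) = \<pi> b * (\<pi> (f a) * v x)" if "a \<in> carrier A" for a
    using 2[OF that] that b by (simp add: m_assoc)
  have 4: "v (b \<otimes> x \<otimes> (x \<otimes> a)) = \<pi> b * (\<pi> (y \<otimes> a) * v \<one>)" if "a \<in> carrier A" for a
  proof -
    have "b \<otimes> x \<otimes> (x \<otimes> a) = b \<otimes> (y \<otimes> a)"
      using that b x_mult_x by (metis A_closed m_assoc m_closed x_closed)
    then show ?thesis using 1[of "y \<otimes> a"] that y_A by simp
  qed
  have bG: "b \<in> carrier G" "b \<otimes> x \<in> carrier G" using b by simp_all
  show ?A unfolding sum_convolution[OF bG(1)] sum_carrier_G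
    by (simp add: 1 2 sum_distrib_left sum_distrib_right algebra_simps)
  show ?B unfolding sum_convolution[OF bG(2)] sum_carrier_G
    by (simp add: 3 4 sum_distrib_left sum_distrib_right algebra_simps)
qed

lemmas hom_unitsD = A.hom_complex_unitsD[unfolded mult_A one_A]

text \<open>
  The characteristic equation of the \<open>2 \<times> 2\<close> matrix in \<open>convolution_equivariant\<close>, which acts on the
  pairs \<open>(v \<one>, v x)\<close>.
\<close>

definition block_eigenvalue :: "('a \<Rightarrow> complex) \<Rightarrow> ('a \<Rightarrow> complex) \<Rightarrow> complex \<Rightarrow> bool" where
  "block_eigenvalue w \<pi> k \<longleftrightarrow>
     (k - (\<Sum>a\<in>carrier A. w a * \<pi> a)) * (k - (\<Sum>a\<in>carrier A. w a * \<pi> (f a))) =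
     (\<Sum>a\<in>carrier A. w (x \<otimes> a) * \<pi> (f a)) * (\<Sum>a\<in>carrier A. w (x \<otimes> a) * \<pi> (y \<otimes> a))"

text \<open>One direction finds a common translation eigenvector inside the eigenspace; the other
  spreads an eigenvector of the block over G by equivariance.\<close>

lemma convolution_eigenvalue_iff:
  fixes w :: "'a \<Rightarrow> complex"
  shows "matrix_eigenvalue (carrier G) (\<lambda>g h. w (inv g \<otimes> h)) k \<longleftrightarrow>
    (\<exists>\<pi>\<in>hom A complex_units. block_eigenvalue w \<pi> k)"
proof
  assume "matrix_eigenvalue (carrier G) (\<lambda>g h. w (inv g \<otimes> h)) k"
  then have ex: "\<exists>v\<in>{v. \<forall>g\<in>carrier G. (\<Sum>h\<in>carrier G. w (inv g \<otimes> h) * v h) = k * v g}.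
      \<exists>g\<in>carrier G. v g \<noteq> 0" (is "\<exists>v\<in>?E. _")
    unfolding matrix_eigenvalue_def by blast
  have "\<exists>v\<in>?E. (\<exists>g\<in>carrier G. v g \<noteq> 0) \<and>
      (\<forall>a\<in>carrier A. \<exists>c. \<forall>g\<in>carrier G. v (a \<otimes> g) = c * v g)"
  \<comment> \<open>\<open>?E\<close> is the eigenspace for \<open>k\<close>;
    \<open>sum_convolution\<close> rewrites the matrix as a right convolution, so left translations
    preserve it.\<close>
  proof (rule common_translation_eigenvector[OF finite_G _ A_comm _ _ ex])
    fix n :: nat and c :: "nat \<Rightarrow> complex" and u :: "nat \<Rightarrow> 'a \<Rightarrow> complex"
    assume u: "\<And>j. u j \<in> ?E"
    show "(\<lambda>g. \<Sum>j<n. c j * u j g) \<in> ?E"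
    proof (intro CollectI ballI)
      fix g assume g: "g \<in> carrier G"
      have "(\<Sum>h\<in>carrier G. w (inv g \<otimes> h) * (\<Sum>j<n. c j * u j h))
          = (\<Sum>j<n. c j * (\<Sum>h\<in>carrier G. w (inv g \<otimes> h) * u j h))"
        unfolding sum_distrib_left by (subst sum.swap) (simp add: mult.left_commute)
      also have "\<dots> = k * (\<Sum>j<n. c j * u j g)"
        using u g by (simp add: sum_distrib_left mult.left_commute)
      finally show "(\<Sum>h\<in>carrier G. w (inv g \<otimes> h) * (\<Sum>j<n. c j * u j h))
          = k * (\<Sum>j<n. c j * u j g)" .
    qed
  next
    fix a v assume a: "a \<in> carrier G" and v: "v \<in> ?E"
    show "(\<lambda>g. v (a \<otimes> g)) \<in> ?E"
    proof (intro CollectI ballI)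
      fix g assume g: "g \<in> carrier G"
      have "(\<Sum>h\<in>carrier G. w (inv g \<otimes> h) * v (a \<otimes> h))
          = (\<Sum>s\<in>carrier G. w s * v (a \<otimes> g \<otimes> s))"
        unfolding sum_convolution[OF g, where v = "\<lambda>h. v (a \<otimes> h)"]
        by (rule sum.cong) (use a g in \<open>simp_all add: m_assoc\<close>)
      also have "\<dots> = k * v (a \<otimes> g)"
        using v a g sum_convolution[of "a \<otimes> g" w v] by simp
      finally show "(\<Sum>h\<in>carrier G. w (inv g \<otimes> h) * v (a \<otimes> h)) = k * v (a \<otimes> g)" .
    qed
  qed auto
  then obtain v g0 where vE: "v \<in> ?E" and g0: "g0 \<in> carrier G" "v g0 \<noteq> 0"
    and ev: "\<forall>a\<in>carrier A. \<exists>c. \<forall>g\<in>carrier G. v (a \<otimes> g) = c * v g"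
    by blast
  have v: "\<And>g. g \<in> carrier G \<Longrightarrow> (\<Sum>h\<in>carrier G. w (inv g \<otimes> h) * v h) = k * v g"
    using vE by blast
  obtain \<pi> where \<pi>: "\<And>a g. a \<in> carrier A \<Longrightarrow> g \<in> carrier G \<Longrightarrow> v (a \<otimes> g) = \<pi> a * v g"
    using bchoice[OF ev] by blast
  \<comment> \<open>Cancelling the nonzero \<open>v g0\<close> shows that the scalars chosen for the
    single translations form a character.\<close>
  have \<pi>1: "\<pi> \<one> = 1" using \<pi>[of \<one> g0] g0 by simp
  have \<pi>m: "\<pi> (a \<otimes> b) = \<pi> a * \<pi> b" if "a \<in> carrier A" "b \<in> carrier A" for a b
    using \<pi>[of "a \<otimes> b" g0] \<pi>[of a "b \<otimes> g0"] \<pi>[of b g0] g0 that by (simp add: m_assoc)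
  have "\<pi> a \<noteq> 0" if "a \<in> carrier A" for a
    using \<pi>m[of a "inv a"] \<pi>1 that by auto
  then have "\<pi> \<in> hom A complex_units"
    using \<pi>m by (auto simp: hom_def complex_units_def)
  moreover have "v \<one> \<noteq> 0 \<or> v x \<noteq> 0"
    using g0(1)
  proof (cases rule: carrier_G_cases)
    case (1 a)
    then show ?thesis using \<pi>[of a \<one>] g0 by auto
  next
    case (2 a)
    then show ?thesis using \<pi>[of a x] g0 by auto
  qed
  moreover have "(\<Sum>a\<in>carrier A. w a * \<pi> a) * v \<one> + (\<Sum>a\<in>carrier A. w (x \<otimes> a) * \<pi> (f a)) * v x = k * v \<one>"
    using convolution_equivariant(1)[where v = v and w = w, OF \<pi> A_one_closed] v[OF one_closed] \<pi>1
    by simp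
  moreover have "(\<Sum>a\<in>carrier A. w (x \<otimes> a) * \<pi> (y \<otimes> a)) * v \<one> + (\<Sum>a\<in>carrier A. w a * \<pi> (f a)) * v x = k * v x"
    using convolution_equivariant(2)[where v = v and w = w, OF \<pi> A_one_closed] v[OF x_closed] \<pi>1
    by simp
  ultimately show "\<exists>\<pi>\<in>hom A complex_units. block_eigenvalue w \<pi> k"
    unfolding block_eigenvalue_def eigenvalue_2x2_iff[symmetric] by blast
next
  assume "\<exists>\<pi>\<in>hom A complex_units. block_eigenvalue w \<pi> k"
  then obtain \<pi> p q where \<pi>: "\<pi> \<in> hom A complex_units" and pq: "p \<noteq> 0 \<or> q \<noteq> 0"
    and p: "(\<Sum>a\<in>carrier A. w a * \<pi> a) * p + (\<Sum>a\<in>carrier A. w (x \<otimes> a) * \<pi> (f a)) * q = k * p"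
    and q: "(\<Sum>a\<in>carrier A. w (x \<otimes> a) * \<pi> (y \<otimes> a)) * p + (\<Sum>a\<in>carrier A. w a * \<pi> (f a)) * q = k * q"
    unfolding block_eigenvalue_def eigenvalue_2x2_iff[symmetric] by blast
  note \<pi>D = hom_unitsD[OF \<pi>]
  \<comment> \<open>The equivariant function with values \<open>p\<close> at \<open>\<one>\<close>
    and \<open>q\<close> at \<open>x\<close>; off A, \<open>g \<otimes> inv x\<close> is the factor
    of \<open>g\<close> in A.\<close>
  define v where "v g = (if g \<in> carrier A then \<pi> g * p else \<pi> (g \<otimes> inv x) * q)" for g
  have vA: "v a = \<pi> a * p" if "a \<in> carrier A" for a using that by (simp add: v_def)
  have vx: "v (a \<otimes> x) = \<pi> a * q" if "a \<in> carrier A" for a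
    using that mult_x_notin_A[OF that] by (simp add: v_def m_assoc)
  have v: "v (a \<otimes> g) = \<pi> a * v g" if a: "a \<in> carrier A" and g: "g \<in> carrier G" for a g
    using g
  proof (cases rule: carrier_G_cases)
    case (1 b)
    then show ?thesis using a by (simp add: vA \<pi>D)
  next
    case (2 b)
    then show ?thesis using a vx[of "a \<otimes> b"] by (simp add: vx \<pi>D m_assoc)
  qed
  have v1: "v \<one> = p" using vA[of \<one>] \<pi>D by simp
  have vx1: "v x = q" using vx[of \<one>] \<pi>D by simp
  have "(\<Sum>h\<in>carrier G. w (inv g \<otimes> h) * v h) = k * v g" if "g \<in> carrier G" for g
    using that
  proof (cases rule: carrier_G_cases)
    case (1 b)
    then show ?thesis
      using convolution_equivariant(1)[where v = v and w = w, OF v] p by (simp add: v1 vx1 vA)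
  next
    case (2 b)
    then show ?thesis
      using convolution_equivariant(2)[where v = v and w = w, OF v] q by (simp add: v1 vx1 vx)
  qed
  moreover have "\<exists>g\<in>carrier G. v g \<noteq> 0" using pq v1 vx1 by (metis one_closed x_closed)
  ultimately show "matrix_eigenvalue (carrier G) (\<lambda>g h. w (inv g \<otimes> h)) k"
    unfolding matrix_eigenvalue_def by blast
qed

section \<open>Characters of A that extend to G\<close>

lemma subset_kernel_iff:
  assumes \<pi>: "\<pi> \<in> hom A complex_units"
  shows "{f a \<otimes>\<^bsub>A\<^esub> inv\<^bsub>A\<^esub> a | a. a \<in> carrier A} \<subseteq> kernel A complex_units \<pi> \<longleftrightarrow>
    (\<forall>a\<in>carrier A. \<pi> (f a) = \<pi> a)"
proof -
  have "\<pi> (f a \<otimes> inv a) = 1 \<longleftrightarrow> \<pi> (f a) = \<pi> a" if a: "a \<in> carrier A" for a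
    using hom_unitsD[OF \<pi>] hom_unitsD(2)[OF \<pi>, of a "inv a"] a
    by (metis A_inv_closed A_closed f_closed mult.commute mult_left_cancel r_inv)
  then show ?thesis by (auto simp: kernel_def complex_units_def)
qed

text \<open>For an \<open>f\<close>-invariant \<open>\<pi>\<close> the diagonal entries coincide and
  the off-diagonal ones differ by the factor \<open>\<pi> y\<close>, so the eigenvalues are
  \<open>P + c * R\<close> for the two square roots \<open>c\<close> of \<open>\<pi> y\<close>.
  These \<open>c\<close> are the possible values at \<open>x\<close> of an extension of
  \<open>\<pi>\<close> to G.\<close>

lemma extendable_block_eigenvalues_iff:
  fixes w :: "'a \<Rightarrow> complex"
  shows "(\<forall>\<pi>\<in>hom A complex_units. (\<forall>a\<in>carrier A. \<pi> (f a) = \<pi> a) \<longrightarrow>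
      (\<forall>k. block_eigenvalue w \<pi> k \<longrightarrow> k \<in> Z)) \<longleftrightarrow>
    (\<forall>\<rho>\<in>hom G complex_units.
      (\<Sum>a\<in>carrier A. w a * \<rho> a) + \<rho> x * (\<Sum>a\<in>carrier A. w (x \<otimes> a) * \<rho> a) \<in> Z)"
  (is "?L \<longleftrightarrow> ?R")
proof
  assume L: ?L
  show ?R
  proof
    fix \<rho> assume \<rho>: "\<rho> \<in> hom G complex_units"
    note nz = hom_complex_unitsD(1)[OF \<rho>] and m = hom_complex_unitsD(2)[OF \<rho>]
    have hA: "\<rho> \<in> hom A complex_units"
      using m nz by (auto simp: hom_def complex_units_def)
    \<comment> \<open>\<open>f\<close> is conjugation by \<open>x\<close>, invisible to a
      homomorphism into a commutative group.\<close>
    have fa: "\<rho> (f a) = \<rho> a" if "a \<in> carrier A" for a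
      using m[of x a] m[of "f a" x] x_mult[OF that] nz[of x] that by simp
    have yx: "\<rho> y = \<rho> x * \<rho> x" using m[of x x] x_mult_x by simp
    have "block_eigenvalue w \<rho>
      ((\<Sum>a\<in>carrier A. w a * \<rho> a) + \<rho> x * (\<Sum>a\<in>carrier A. w (x \<otimes> a) * \<rho> a))"
      unfolding block_eigenvalue_def
      by (simp add: fa m y_A yx sum_distrib_left[symmetric] mult.left_commute[of "w _"])
    then show "(\<Sum>a\<in>carrier A. w a * \<rho> a) + \<rho> x * (\<Sum>a\<in>carrier A. w (x \<otimes> a) * \<rho> a) \<in> Z"
      using L hA fa by blast
  qed
next
  assume R: ?R
  show ?L
  proof (intro ballI impI allI)
    fix \<pi> k assume \<pi>: "\<pi> \<in> hom A complex_units" and fa: "\<forall>a\<in>carrier A. \<pi> (f a) = \<pi> a"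
      and k: "block_eigenvalue w \<pi> k"
    interpret C: comm_group complex_units by (rule comm_group_complex_units)
    note \<pi>D = hom_unitsD[OF \<pi>]
    define P where "P = (\<Sum>a\<in>carrier A. w a * \<pi> a)"
    define R where "R = (\<Sum>a\<in>carrier A. w (x \<otimes> a) * \<pi> a)"
    have ext: "P + c * R \<in> Z" if c: "c * c = \<pi> y" for c
    proof -
      have c0: "c \<in> carrier complex_units"
        using c \<pi>D(1)[OF y_A] by (auto simp: complex_units_def)
      have \<pi>C: "\<pi> a \<in> carrier complex_units" if "a \<in> carrier A" for a
        using \<pi>D that by (auto simp: complex_units_def)
      \<comment> \<open>The universal property asks for \<open>c * c = \<pi> y\<close> and, the
        target being commutative, for the invariance of \<open>\<pi>\<close> under
        \<open>f\<close>.\<close>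
      have "\<exists>\<psi>\<in>hom G complex_units. (\<forall>a\<in>carrier A. \<psi> a = \<pi> a) \<and> \<psi> x = c"
      proof (rule index2_presentation_universal[OF presentation comm_A _ y_A C.is_group \<pi> c0])
        show "c \<otimes>\<^bsub>complex_units\<^esub> c = \<pi> y" using c by (simp add: complex_units_def)
        fix a assume a: "a \<in> carrier A"
        have "c \<otimes>\<^bsub>complex_units\<^esub> \<pi> a = \<pi> a \<otimes>\<^bsub>complex_units\<^esub> c"
          by (simp add: complex_units_def)
        then show "c \<otimes>\<^bsub>complex_units\<^esub> \<pi> a \<otimes>\<^bsub>complex_units\<^esub> inv\<^bsub>complex_units\<^esub> c = \<pi> (f a)"
          using a fa c0 \<pi>C[OF a] by (simp add: C.m_assoc)
      qed auto
      then obtain \<psi> where \<psi>: "\<psi> \<in> hom G complex_units" "\<And>a. a \<in> carrier A \<Longrightarrow> \<psi> a = \<pi> a" "\<psi> x = c"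
        by blast
      then show ?thesis using R unfolding P_def R_def by (metis (no_types, lifting) sum.cong)
    qed
    define c where "c = csqrt (\<pi> y)"
    have c: "c * c = \<pi> y" by (simp add: c_def power2_eq_square[symmetric])
    have "(k - P) * (k - P) = R * (\<pi> y * R)"
      using k fa unfolding block_eigenvalue_def P_def R_def
      by (simp add: y_A \<pi>D sum_distrib_left mult.left_commute)
    then have "(k - P)\<^sup>2 = (c * R)\<^sup>2" by (simp add: power2_eq_square c[symmetric])
    then have "k - P = c * R \<or> k - P = - c * R" by (simp add: power2_eq_iff)
    then have "k = P + c * R \<or> k = P + - c * R" by (auto simp: algebra_simps)
    then show "k \<in> Z" using ext[of c] ext[of "- c"] c by auto
  qed
qed

section \<open>Indicator sums and involutions of A\<close>

lemma sum_of_bool: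
  assumes "D \<subseteq> carrier A"
  shows "(\<Sum>a\<in>carrier A. of_bool (a \<in> D) * F a) = (sum F D :: complex)"
proof -
  have "(\<Sum>a\<in>carrier A. of_bool (a \<in> D) * F a) = (\<Sum>a\<in>carrier A. if a \<in> D then F a else 0)"
    by (rule sum.cong) auto
  also have "\<dots> = sum F (carrier A \<inter> D)" by (rule sum.inter_restrict[OF finite_A, symmetric])
  finally show ?thesis using assms by (simp add: Int_absorb1)
qed

lemma sum_of_bool_involution:
  assumes "D \<subseteq> carrier A" and j: "\<And>a. a \<in> carrier A \<Longrightarrow> j a \<in> carrier A \<and> j (j a) = a"
  shows "(\<Sum>a\<in>carrier A. of_bool (j a \<in> D) * F a) = (\<Sum>a\<in>D. F (j a) :: complex)"
proof -
  have "(\<Sum>a\<in>carrier A. of_bool (j a \<in> D) * F a) = (\<Sum>a\<in>carrier A. of_bool (a \<in> D) * F (j a))"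
    by (rule sum.reindex_bij_witness[where i = j and j = j]) (use j in auto)
  then show ?thesis using sum_of_bool[OF assms(1)] by simp
qed

text \<open>By \<open>inv_x_mult\<close> this map is inversion on \<open>x <# carrier A\<close> read
  off in A, hence its own inverse.\<close>

lemma coset_involution:
  assumes "a \<in> carrier A"
  shows "inv y \<otimes> inv (f a) \<in> carrier A \<and> inv y \<otimes> inv (f (inv y \<otimes> inv (f a))) = a"
proof -
  have "inv y \<otimes> inv (f (inv y \<otimes> inv (f a))) = inv y \<otimes> (a \<otimes> y)"
    using assms y_A by (simp add: inv_mult_group)
  also have "\<dots> = a" using assms y_A A_comm[of a y] by (simp add: m_assoc[symmetric])
  finally show ?thesis using assms y_A by simp
qed

end

section \<open>The mixed Cayley graph as a convolution\<close>

locale index2_mixed_cayley = index2_extension +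
  fixes S T S1 S2 T1 T2 :: "'a set"
  assumes S_sub: "S \<subseteq> carrier G - {\<one>}" and T_def: "T = {s \<in> S. inv s \<notin> S}"
    and S1: "S1 \<subseteq> carrier A" and S2: "S2 \<subseteq> carrier A"
    and T1: "T1 \<subseteq> carrier A" and T2: "T2 \<subseteq> carrier A"
    and S_split: "S - T = S1 \<union> (x <# S2)" and T_split: "T = T1 \<union> (x <# T2)"
begin

text \<open>The convolution kernel of the Hermitian adjacency matrix. For \<open>s\<close> in G at
  most one indicator is nonzero: they stand for arcs in both directions, forward only and backward
  only.\<close>

definition weight :: "'a \<Rightarrow> complex" where
  "weight s = of_bool (s \<in> S - T) + \<i> * of_bool (s \<in> T) - \<i> * of_bool (inv s \<in> T)"

lemma T_iff: "s \<in> T \<longleftrightarrow> s \<in> S \<and> inv s \<notin> S"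
  by (subst T_def) simp

lemma hermitian_adjacency_Cay:
  assumes "g \<in> carrier G" "h \<in> carrier G"
  shows "hermitian_adjacency (Cay G S) g h = weight (inv g \<otimes> h)"
proof -
  have "inv (inv g \<otimes> h) = inv h \<otimes> g" using assms by (simp add: inv_mult_group)
  moreover have "inv (inv h \<otimes> g) = inv g \<otimes> h" using assms by (simp add: inv_mult_group)
  ultimately show ?thesis using assms
    by (auto simp: hermitian_adjacency_def Cay_def weight_def T_iff)
qed

lemma matrix_eigenvalue_Cay:
  "matrix_eigenvalue (carrier G) (hermitian_adjacency (Cay G S)) k \<longleftrightarrow>
   (\<exists>\<pi>\<in>hom A complex_units. block_eigenvalue weight \<pi> k)"
  unfolding convolution_eigenvalue_iff[symmetric] matrix_eigenvalue_def
  by (simp add: hermitian_adjacency_Cay cong: sum.cong)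

text \<open>The block entries are sums of character values, so integrality is drawn from the full
  matrix, whose entries are the Gaussian integers 0, 1, \<i> and -\<i>.\<close>

lemma rational_block_eigenvalue:
  assumes "\<pi> \<in> hom A complex_units" "block_eigenvalue weight \<pi> k" "k \<in> \<rat>"
  shows "k \<in> \<int>"
proof (rule rational_eigenvalue_gaussian_int_matrix[OF finite_G])
  show "matrix_eigenvalue (carrier G) (hermitian_adjacency (Cay G S)) k"
    using assms matrix_eigenvalue_Cay by blast
qed (use assms in \<open>auto simp: hermitian_adjacency_def\<close>)

lemma integral_Cay_iff:
  "integral_mixed_graph (Cay G S) \<longleftrightarrow>
   (\<forall>\<pi>\<in>hom A complex_units. \<forall>k. block_eigenvalue weight \<pi> k \<longrightarrow> k \<in> \<int>)"
proof -
  have "pverts (Cay G S) = carrier G" by (simp add: Cay_def)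
  then show ?thesis unfolding integral_mixed_graph_def by (auto simp: matrix_eigenvalue_Cay)
qed

section \<open>Weighted sums over the two cosets\<close>

lemma coset_split_iff:
  assumes a: "a \<in> carrier A"
  shows "a \<in> S - T \<longleftrightarrow> a \<in> S1" "a \<in> T \<longleftrightarrow> a \<in> T1"
    "x \<otimes> a \<in> S - T \<longleftrightarrow> a \<in> S2" "x \<otimes> a \<in> T \<longleftrightarrow> a \<in> T2"
proof -
  have split: "g \<in> S - T \<longleftrightarrow> g \<in> S1 \<or> g \<in> x <# S2" "g \<in> T \<longleftrightarrow> g \<in> T1 \<or> g \<in> x <# T2" for g
    using S_split T_split by blast+
  have "a \<notin> x <# D" if "D \<subseteq> carrier A" for D
    using x_mult_notin_A a that by (auto simp: l_coset_def)
  then show "a \<in> S - T \<longleftrightarrow> a \<in> S1" "a \<in> T \<longleftrightarrow> a \<in> T1"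
    using S2 T2 unfolding split by auto
  have "x \<otimes> a \<in> x <# D \<longleftrightarrow> a \<in> D" if "D \<subseteq> carrier A" for D
  proof -
    have "d = a" if "d \<in> D" "x \<otimes> a = x \<otimes> d" for d
      using that a \<open>D \<subseteq> carrier A\<close> l_cancel[of x a d] by auto
    then show ?thesis by (auto simp: l_coset_def)
  qed
  then show "x \<otimes> a \<in> S - T \<longleftrightarrow> a \<in> S2" "x \<otimes> a \<in> T \<longleftrightarrow> a \<in> T2"
    using x_mult_notin_A[OF a] S1 S2 T1 T2 unfolding split by auto
qed

lemma weight_A: "a \<in> carrier A \<Longrightarrow>
    weight a = of_bool (a \<in> S1) + \<i> * of_bool (a \<in> T1) - \<i> * of_bool (inv a \<in> T1)"
  by (simp only: weight_def coset_split_iff A_inv_closed)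

lemma weight_x: "a \<in> carrier A \<Longrightarrow>
    weight (x \<otimes> a) = of_bool (a \<in> S2) + \<i> * of_bool (a \<in> T2) - \<i> * of_bool (inv y \<otimes> inv (f a) \<in> T2)"
  by (simp only: weight_def coset_split_iff inv_x_mult A_inv_closed A_m_closed y_A f_closed)

text \<open>\<open>F\<close> stays general because the blocks need it for \<open>\<pi>\<close> and
  for \<open>\<pi>\<close> after \<open>f\<close>, and the first condition for
  \<open>\<rho>\<close>.\<close>

lemma sum_weight_A:
  "(\<Sum>a\<in>carrier A. weight a * F a) = sum F S1 + \<i> * (sum F T1 - (\<Sum>t\<in>T1. F (inv t)))"
proof -
  have "(\<Sum>a\<in>carrier A. weight a * F a) =
      (\<Sum>a\<in>carrier A. of_bool (a \<in> S1) * F a) + \<i> * ((\<Sum>a\<in>carrier A. of_bool (a \<in> T1) * F a)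
        - (\<Sum>a\<in>carrier A. of_bool (inv a \<in> T1) * F a))"
    unfolding sum_distrib_left sum_subtractf[symmetric] sum.distrib[symmetric]
    by (rule sum.cong) (simp_all add: weight_A algebra_simps)
  then show ?thesis by (simp add: sum_of_bool sum_of_bool_involution S1 T1)
qed

lemma sum_weight_x:
  "(\<Sum>a\<in>carrier A. weight (x \<otimes> a) * F a) =
   sum F S2 + \<i> * (sum F T2 - (\<Sum>t\<in>T2. F (inv y \<otimes> inv (f t))))"
proof -
  have "(\<Sum>a\<in>carrier A. weight (x \<otimes> a) * F a) =
      (\<Sum>a\<in>carrier A. of_bool (a \<in> S2) * F a) + \<i> * ((\<Sum>a\<in>carrier A. of_bool (a \<in> T2) * F a)
        - (\<Sum>a\<in>carrier A. of_bool (inv y \<otimes> inv (f a) \<in> T2) * F a))"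
    unfolding sum_distrib_left sum_subtractf[symmetric] sum.distrib[symmetric]
    by (rule sum.cong) (simp_all add: weight_x algebra_simps)
  then show ?thesis
    using sum_of_bool_involution[OF T2, of "\<lambda>a. inv y \<otimes> inv (f a)" F] coset_involution
    by (simp add: sum_of_bool S2 T2)
qed

text \<open>\<open>S - T\<close> is closed under inversion, and this is what inversion does to its
  part in the nontrivial coset.\<close>

lemma S2_coset_involution:
  assumes s: "s \<in> S2" shows "inv y \<otimes> inv (f s) \<in> S2"
proof -
  have sA: "s \<in> carrier A" using s S2 by blast
  then have "x \<otimes> s \<in> S - T" using coset_split_iff s by blast
  then have "inv (x \<otimes> s) \<in> S - T" using S_sub by (auto simp: T_iff)
  then show ?thesis using coset_split_iff(3)[of "inv y \<otimes> inv (f s)"] inv_x_mult[OF sA] sA y_A by simp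
qed

lemma sum_S2_inv:
  fixes F :: "'a \<Rightarrow> complex"
  shows "(\<Sum>s\<in>S2. F (y \<otimes> f s)) = (\<Sum>s\<in>S2. F (inv s))"
proof (rule sum.reindex_bij_witness[where
    i = "\<lambda>s. inv y \<otimes> inv (f s)" and j = "\<lambda>s. inv y \<otimes> inv (f s)"])
  fix s assume s: "s \<in> S2"
  then have sA: "s \<in> carrier A" using S2 by blast
  show "inv y \<otimes> inv (f s) \<in> S2" by (rule S2_coset_involution[OF s])
  show "inv y \<otimes> inv (f (inv y \<otimes> inv (f s))) = s" using coset_involution[OF sA] by blast
  show "F (inv (inv y \<otimes> inv (f s))) = F (y \<otimes> f s)"
    using sA y_A A_comm[of y "f s"] by (simp add: inv_mult_group)
qed (use S2_coset_involution coset_involution S2 in blast)+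

section \<open>Trace and determinant of a block\<close>

text \<open>\<open>\<delta>\<close> is the trace and \<open>\<epsilon>\<close> the determinant of
  the block, so \<open>integer_roots_iff\<close> applies; its rationality assumption comes from the
  full matrix.\<close>

lemma integer_block_eigenvalues_iff:
  assumes \<pi>: "\<pi> \<in> hom A complex_units"
  shows "(\<forall>k. block_eigenvalue weight \<pi> k \<longrightarrow> k \<in> \<int>) \<longleftrightarrow>
      (let \<alpha> = sum \<pi> T1 - sum \<pi> (m_inv A ` T1);
           \<beta> = sum \<pi> (y <#\<^bsub>A\<^esub> f ` T2) - sum \<pi> (m_inv A ` T2);
           \<gamma> = sum \<pi> (f ` T1) - sum \<pi> (f ` m_inv A ` T1);
           \<delta> = sum \<pi> (f ` S1) + sum \<pi> S1 + \<i> * (\<alpha> + \<gamma>);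
           \<epsilon> = sum \<pi> S1 * sum \<pi> (f ` S1) - sum \<pi> S2 * sum \<pi> (m_inv A ` S2)
               + \<i> * (sum \<pi> S1 * \<gamma> + sum \<pi> (f ` S1) * \<alpha>
                       - \<beta> * sum \<pi> S2 + cnj \<beta> * sum \<pi> (m_inv A ` S2))
               - \<alpha> * \<gamma> - \<beta> * cnj \<beta>
       in \<delta> \<in> \<int> \<and> (\<exists>\<zeta>::int. \<delta>\<^sup>2 - 4 * \<epsilon> = (of_int \<zeta>)\<^sup>2))"
proof -
  note \<pi>D = hom_unitsD[OF \<pi>]
  have \<pi>inv: "\<pi> (inv a) = cnj (\<pi> a)" if "a \<in> carrier A" for a
    using A.hom_complex_units_inv[OF finite_A \<pi> that] that by simp
  \<comment> \<open>The sums in the claim run over image sets; injectivity of \<open>f\<close>,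
    inversion and translation by \<open>y\<close> turns them into indexed sums.\<close>
  have sum_f: "sum \<pi> (f ` D) = (\<Sum>a\<in>D. \<pi> (f a))" if "D \<subseteq> carrier A" for D
    using inj_on_f that by (simp add: sum.reindex inj_on_subset)
  have sum_inv: "sum \<pi> (m_inv A ` D) = cnj (sum \<pi> D)" if D: "D \<subseteq> carrier A" for D
  proof -
    have "inj_on (m_inv A) D" using A.inv_inj D by (rule inj_on_subset)
    then show ?thesis using D \<pi>inv by (auto simp: sum.reindex cnj_sum intro!: sum.cong)
  qed
  have sum_f_inv: "sum \<pi> (f ` m_inv A ` D) = cnj (\<Sum>a\<in>D. \<pi> (f a))" if D: "D \<subseteq> carrier A" for D
  proof -
    have "f ` m_inv A ` D = m_inv A ` f ` D" using D by (force simp: image_image)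
    moreover have "f ` D \<subseteq> carrier A" using D by auto
    ultimately show ?thesis using sum_inv[of "f ` D"] sum_f[OF D] by simp
  qed
  have sum_y: "sum \<pi> (y <#\<^bsub>A\<^esub> f ` D) = \<pi> y * (\<Sum>a\<in>D. \<pi> (f a))" if D: "D \<subseteq> carrier A" for D
  proof -
    have "y <#\<^bsub>A\<^esub> f ` D = (\<lambda>a. y \<otimes> f a) ` D" by (auto simp: l_coset_def)
    moreover have "inj_on (\<lambda>a. y \<otimes> f a) D"
      using D y_A inj_on_f by (auto simp: inj_on_def subset_iff)
    ultimately show ?thesis
      using D y_A \<pi>D(2) by (auto simp: sum.reindex sum_distrib_left intro!: sum.cong)
  qed
  define p s1 g1 t1 h1 s2 g2 t2 h2 where "p = \<pi> y"
    and "s1 = sum \<pi> S1" and "g1 = (\<Sum>a\<in>S1. \<pi> (f a))"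
    and "t1 = sum \<pi> T1" and "h1 = (\<Sum>a\<in>T1. \<pi> (f a))"
    and "s2 = sum \<pi> S2" and "g2 = (\<Sum>a\<in>S2. \<pi> (f a))"
    and "t2 = sum \<pi> T2" and "h2 = (\<Sum>a\<in>T2. \<pi> (f a))"
  note defs = this
  have p: "p * cnj p = 1"
    using \<pi>D(2)[of y "inv y"] \<pi>D(3) \<pi>inv y_A by (simp add: defs)
  \<comment> \<open>Closure of \<open>S - T\<close> under inversion ties the sum over
    \<open>f\<close> of \<open>S2\<close> to a conjugate, so \<open>g2\<close> can be eliminated
    from the determinant.\<close>
  have s2: "cnj s2 = p * g2"
  proof -
    have "p * g2 = (\<Sum>s\<in>S2. \<pi> (y \<otimes> f s))"
      using S2 y_A \<pi>D(2) by (auto simp: defs sum_distrib_left intro!: sum.cong)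
    also have "\<dots> = cnj s2"
      using S2 \<pi>inv by (auto simp: sum_S2_inv defs cnj_sum intro!: sum.cong)
    finally show ?thesis by simp
  qed
  define P Q R U where "P = s1 + \<i> * (t1 - cnj t1)" and "Q = g1 + \<i> * (h1 - cnj h1)"
    and "R = g2 + \<i> * (h2 - cnj p * cnj t2)" and "U = p * s2 + \<i> * (p * t2 - cnj h2)"
  note blocks = this
  have P: "(\<Sum>a\<in>carrier A. weight a * \<pi> a) = P"
    using T1 \<pi>inv by (auto simp: sum_weight_A blocks defs cnj_sum intro!: sum.cong)
  have Q: "(\<Sum>a\<in>carrier A. weight a * \<pi> (f a)) = Q"
    using T1 \<pi>inv by (auto simp: sum_weight_A blocks defs cnj_sum subset_iff intro!: sum.cong)
  have R: "(\<Sum>a\<in>carrier A. weight (x \<otimes> a) * \<pi> (f a)) = R"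
  proof -
    have "(\<Sum>t\<in>T2. \<pi> (f (inv y \<otimes> inv (f t)))) = cnj p * cnj t2"
      using T2 y_A \<pi>D(2) \<pi>inv
      by (auto simp: defs cnj_sum sum_distrib_left subset_iff intro!: sum.cong)
    then show ?thesis by (simp add: sum_weight_x blocks defs)
  qed
  have U: "(\<Sum>a\<in>carrier A. weight (x \<otimes> a) * \<pi> (y \<otimes> a)) = U"
  proof -
    have "(\<Sum>t\<in>T2. \<pi> (y \<otimes> (inv y \<otimes> inv (f t)))) = cnj h2"
      using T2 y_A \<pi>inv
      by (auto simp: defs cnj_sum subset_iff m_assoc[symmetric] intro!: sum.cong)
    moreover have "(\<Sum>a\<in>D. \<pi> (y \<otimes> a)) = p * sum \<pi> D" if "D \<subseteq> carrier A" for D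
      using that y_A \<pi>D(2) by (auto simp: defs sum_distrib_left intro!: sum.cong)
    ultimately show ?thesis using S2 T2 by (simp add: sum_weight_x blocks) (simp add: defs)
  qed
  have block: "block_eigenvalue weight \<pi> k \<longleftrightarrow> (k - P) * (k - Q) = R * U" for k
    unfolding block_eigenvalue_def P Q R U ..
  \<comment> \<open>This is \<open>\<beta>\<close>. Moving the unimodular \<open>p\<close> from
    \<open>U\<close> to \<open>R\<close> leaves the product unchanged and expresses both factors
    through \<open>s2\<close>, \<open>b\<close> and conjugates.\<close>
  define b where "b = p * h2 - cnj t2"
  have "p * R = cnj s2 + \<i> * b"
    using p by (simp add: blocks b_def s2 algebra_simps)
  moreover have "U = p * (s2 - \<i> * cnj b)"
    using p by (simp add: blocks b_def algebra_simps)
  ultimately have RU: "R * U = (cnj s2 + \<i> * b) * (s2 - \<i> * cnj b)"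
    by (metis mult.assoc mult.commute)
  have \<epsilon>: "P * Q - R * U = s1 * g1 - s2 * cnj s2
      + \<i> * (s1 * (h1 - cnj h1) + g1 * (t1 - cnj t1) - b * s2 + cnj b * cnj s2)
      - (t1 - cnj t1) * (h1 - cnj h1) - b * cnj b"
    unfolding RU by (simp add: blocks algebra_simps)
  have \<delta>: "P + Q = g1 + s1 + \<i> * (t1 - cnj t1 + (h1 - cnj h1))"
    by (simp add: blocks algebra_simps)
  have "(\<forall>k. (k - P) * (k - Q) = R * U \<longrightarrow> k \<in> \<int>) \<longleftrightarrow>
    P + Q \<in> \<int> \<and> (\<exists>\<zeta>::int. (P + Q)\<^sup>2 - 4 * (P * Q - R * U) = (of_int \<zeta>)\<^sup>2)"
    using rational_block_eigenvalue[OF \<pi>] unfolding block by (intro integer_roots_iff) blast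
  then show ?thesis
    unfolding block Let_def sum_f[OF S1] sum_f[OF T1] sum_inv[OF T1] sum_inv[OF T2] sum_inv[OF S2]
      sum_f_inv[OF T1] sum_y[OF T2] defs[symmetric] b_def[symmetric] \<epsilon> \<delta> .
qed

section \<open>One-dimensional representations of G and the conclusion\<close>

lemma one_dimensional_eigenvalue:
  assumes \<rho>: "\<rho> \<in> hom G complex_units"
  shows "(\<Sum>a\<in>carrier A. weight a * \<rho> a) + \<rho> x * (\<Sum>a\<in>carrier A. weight (x \<otimes> a) * \<rho> a) =
    sum \<rho> S1 + \<rho> x * sum \<rho> S2
      - 2 * complex_of_real (Im (sum \<rho> T1)) - 2 * complex_of_real (Im (\<rho> x * sum \<rho> T2))"
proof -
  note m = hom_complex_unitsD(2)[OF \<rho>]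
  have inv: "\<rho> (inv g) = cnj (\<rho> g)" if "g \<in> carrier G" for g
    using hom_complex_units_inv[OF finite_G \<rho> that] .
  have im: "\<i> * (z - cnj z) = - 2 * complex_of_real (Im z)" for z
    by (simp add: complex_eq_iff)
  \<comment> \<open>Both sides are the value of \<open>\<rho>\<close> at
    \<open>inv (x \<otimes> t)\<close>; the terms from \<open>T\<close> thus pair with their
    conjugates and leave imaginary parts.\<close>
  have "\<rho> x * \<rho> (inv y \<otimes> inv (f t)) = cnj (\<rho> x * \<rho> t)" if "t \<in> T2" for t
    using that T2 m[of x "inv y \<otimes> inv (f t)"] inv[of "x \<otimes> t"] m[of x t] inv_x_mult[of t] y_A by auto
  then have "(\<Sum>t\<in>T2. \<rho> x * \<rho> (inv y \<otimes> inv (f t))) = cnj (\<rho> x * sum \<rho> T2)"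
    by (simp add: cnj_sum sum_distrib_left)
  then have x: "\<rho> x * (\<Sum>a\<in>carrier A. weight (x \<otimes> a) * \<rho> a)
      = \<rho> x * sum \<rho> S2 + \<i> * (\<rho> x * sum \<rho> T2 - cnj (\<rho> x * sum \<rho> T2))"
    unfolding sum_weight_x sum_distrib_left[symmetric]
    by (simp only: ring_distribs mult.left_commute[of "\<rho> x"])
  have "(\<Sum>t\<in>T1. \<rho> (inv t)) = cnj (sum \<rho> T1)"
    using T1 inv by (auto simp: cnj_sum intro!: sum.cong)
  then show ?thesis unfolding x sum_weight_A by (simp only: im) simp
qed

end

theorem theorem3p1:
  fixes A G :: "'a monoid" and f :: "'a \<Rightarrow> 'a" and x y :: 'a
    and B S T S1 S2 T1 T2 :: "'a set"
  assumes "comm_group A" and "finite (carrier A)" and "card (carrier A) \<ge> 3"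
    and "f \<in> carrier (AutoGroup A)" and "group.ord (AutoGroup A) f = 2"
    and "y \<in> carrier A" and "f y = y"
    and "index2_presentation G A f y x"
    and "B = {f a \<otimes>\<^bsub>A\<^esub> inv\<^bsub>A\<^esub> a | a. a \<in> carrier A}"
    and "S \<subseteq> carrier G - {\<one>\<^bsub>G\<^esub>}"
    and "T = {s \<in> S. inv\<^bsub>G\<^esub> s \<notin> S}"
    and "S1 \<subseteq> carrier A" and "S2 \<subseteq> carrier A" and "T1 \<subseteq> carrier A" and "T2 \<subseteq> carrier A"
    and "S - T = S1 \<union> (x <#\<^bsub>G\<^esub> S2)" and "T = T1 \<union> (x <#\<^bsub>G\<^esub> T2)"
  shows "integral_mixed_graph (Cay G S) \<longleftrightarrow>
    (\<forall>\<rho> \<in> hom G complex_units.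
       sum \<rho> S1 + \<rho> x * sum \<rho> S2
         - 2 * complex_of_real (Im (sum \<rho> T1)) - 2 * complex_of_real (Im (\<rho> x * sum \<rho> T2)) \<in> \<int>) \<and>
    (\<forall>\<pi> \<in> hom A complex_units. \<not> B \<subseteq> kernel A complex_units \<pi> \<longrightarrow>
      (let \<alpha> = sum \<pi> T1 - sum \<pi> (m_inv A ` T1);
           \<beta> = sum \<pi> (y <#\<^bsub>A\<^esub> f ` T2) - sum \<pi> (m_inv A ` T2);
           \<gamma> = sum \<pi> (f ` T1) - sum \<pi> (f ` m_inv A ` T1);
           \<delta> = sum \<pi> (f ` S1) + sum \<pi> S1 + \<i> * (\<alpha> + \<gamma>);
           \<epsilon> = sum \<pi> S1 * sum \<pi> (f ` S1) - sum \<pi> S2 * sum \<pi> (m_inv A ` S2)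
               + \<i> * (sum \<pi> S1 * \<gamma> + sum \<pi> (f ` S1) * \<alpha>
                       - \<beta> * sum \<pi> S2 + cnj \<beta> * sum \<pi> (m_inv A ` S2))
               - \<alpha> * \<gamma> - \<beta> * cnj \<beta>
       in \<delta> \<in> \<int> \<and> (\<exists>\<zeta>::int. \<delta>\<^sup>2 - 4 * \<epsilon> = (of_int \<zeta>)\<^sup>2)))"
proof -
  have "group G" using assms(8) by (simp add: index2_presentation_def)
  moreover have "f \<in> hom A A" using assms(4) by (simp add: AutoGroup_def auto_def)
  ultimately interpret index2_mixed_cayley G A f x y S T S1 S2 T1 T2
    using assms by (simp add: index2_mixed_cayley_def index2_extension_def
        index2_extension_axioms_def index2_mixed_cayley_axioms_def)
  \<comment> \<open>The characters of A are split by whether they are \<open>f\<close>-invariant,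
    which by \<open>subset_kernel_iff\<close> is the kernel condition on \<open>B\<close>; the
    invariant ones give condition (1) and the others condition (2).\<close>
  have "integral_mixed_graph (Cay G S) \<longleftrightarrow>
    (\<forall>\<pi>\<in>hom A complex_units. (\<forall>a\<in>carrier A. \<pi> (f a) = \<pi> a) \<longrightarrow>
      (\<forall>k. block_eigenvalue weight \<pi> k \<longrightarrow> k \<in> \<int>)) \<and>
    (\<forall>\<pi>\<in>hom A complex_units. \<not> B \<subseteq> kernel A complex_units \<pi> \<longrightarrow>
      (\<forall>k. block_eigenvalue weight \<pi> k \<longrightarrow> k \<in> \<int>))"
    unfolding integral_Cay_iff assms(9) using subset_kernel_iff by blast
  then show ?thesis
    unfolding extendable_block_eigenvalues_iff
    by (simp only: one_dimensional_eigenvalue integer_block_eigenvalues_iff cong: ball_cong)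
qed

end
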